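(* Let $f:\mathbb{N}\to\mathbb{Z}$ satisfy $0\le f(n)\le n$ for all $n$, and suppose that either the average order of $f$ is positive and bounded, or the average order of $f$ is at least linear in $n$. Then for $\mathbb{P}_f$-almost every $P\in\Omega_f$ the following holds: for every non-increasing $\Psi:\mathbb{N}\to\mathbb{R}_{\geq 0}$, \[ \lambda\left(W^P(\Psi)\right)=\begin{cases}1 & \text{if } \sum_{n=1}^\infty f(n)\Psi(n)=\infty,\\ 0 & \text{if } \sum_{n=1}^\infty f(n)\Psi(n)<\infty.\end{cases} \]
   Context: $[n]=\{1,\dots,n\}$. $\Omega_{f,n}$ is the set of subsets $Q\subseteq[n]$ with $\#Q=f(n)$, $\mathbb{P}_{f,n}$ is the uniform probability measure on $\Omega_{f,n}$, $\Omega_f=\prod_{n\ge1}\Omega_{f,n}$, and $\mathbb{P}_f=\bigotimes_{n\ge1}\mathbb{P}_{f,n}$. For $P=(P_n)\in\Omega_f$ and $\Psi:\mathbb{N}\to\mathbb{R}_{\ge0}$, $W^P(\Psi)$ is the set of $x\in[0,1]$ with $|x-a/n|<\Psi(n)$ for infinitely many pairs $(n,a)$ with $n\in\mathbb{N}$, $a\in P_n$. $\lambda$ is Lebesgue measure. "Average order at least linear" means there is $a>0$ with $\sum_{n=1}^N f(n)\ge a\sum_{n=1}^N n$ for all sufficiently large $N$; "average order positive and bounded" means there are constants $0<a<b$ with $aN\le\sum_{n=1}^N f(n)\le bN$ for all sufficiently large $N$. *)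

theory Defs
  imports "HOL-Probability.Probability"
begin

text \<open>The natural numbers of the source start at 1. Functions of type \<open>nat \<Rightarrow> _\<close> are
  therefore only constrained, and only evaluated, at arguments \<open>n \<ge> 1\<close>.\<close>

definition Omega_n :: "(nat \<Rightarrow> int) \<Rightarrow> nat \<Rightarrow> nat set set" where
  "Omega_n f n = {Q. Q \<subseteq> {1..n} \<and> int (card Q) = f n}"

definition P_n :: "(nat \<Rightarrow> int) \<Rightarrow> nat \<Rightarrow> nat set measure" where
  "P_n f n = uniform_count_measure (Omega_n f n)"

definition P_f :: "(nat \<Rightarrow> int) \<Rightarrow> (nat \<Rightarrow> nat set) measure" where
  "P_f f = (\<Pi>\<^sub>M n\<in>{1..}. P_n f n)"

definition W :: "(nat \<Rightarrow> nat set) \<Rightarrow> (nat \<Rightarrow> real) \<Rightarrow> real set" where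
  "W P \<Psi> = {x \<in> {0..1}.
     infinite {(n, a). n \<ge> 1 \<and> a \<in> P n \<and> \<bar>x - real a / real n\<bar> < \<Psi> n}}"

definition average_order_positive_bounded :: "(nat \<Rightarrow> int) \<Rightarrow> bool" where
  "average_order_positive_bounded f \<longleftrightarrow>
     (\<exists>a b :: real. 0 < a \<and> a < b \<and>
        (\<forall>\<^sub>F N in sequentially.
           a * real N \<le> (\<Sum>n = 1..N. real_of_int (f n)) \<and>
           (\<Sum>n = 1..N. real_of_int (f n)) \<le> b * real N))"

definition average_order_at_least_linear :: "(nat \<Rightarrow> int) \<Rightarrow> bool" where
  "average_order_at_least_linear f \<longleftrightarrow>
     (\<exists>a :: real. a > 0 \<and>
        (\<forall>\<^sub>F N in sequentially.
           (\<Sum>n = 1..N. real_of_int (f n)) \<ge> a * (\<Sum>n = 1..N. real n)))"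

lemma finite_Omega_n: "finite (Omega_n f n)"
  by (rule finite_subset[of _ "Pow {1..n}"]) (auto simp: Omega_n_def)

lemma Omega_n_nonempty:
  assumes "0 \<le> f n" "f n \<le> int n"
  shows "Omega_n f n \<noteq> {}"
proof -
  have "{1..nat (f n)} \<in> Omega_n f n"
    using assms by (auto simp: Omega_n_def)
  then show ?thesis by blast
qed

lemma space_P_f: "space (P_f f) = (\<Pi>\<^sub>E n\<in>{1..}. Omega_n f n)"
  by (simp add: P_f_def P_n_def space_PiM space_uniform_count_measure)

lemma prob_space_P_f:
  assumes "\<And>n. n \<ge> 1 \<Longrightarrow> 0 \<le> f n \<and> f n \<le> int n"
  shows "prob_space (P_f f)"
  unfolding P_f_def P_n_def
  using assms
  by (intro prob_space_PiM prob_space_uniform_count_measure finite_Omega_n Omega_n_nonempty) auto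

text \<open>Measurability of the limsup set, so that its \<open>emeasure\<close> is not a default value.\<close>

lemma W_borel: "W P \<Psi> \<in> sets borel"
proof -
  define A where "A p = {x :: real. fst p \<ge> 1 \<and> snd p \<in> P (fst p) \<and>
      \<bar>x - real (snd p) / real (fst p)\<bar> < \<Psi> (fst p)}" for p :: "nat \<times> nat"
  have A [measurable]: "A p \<in> sets borel" for p
    unfolding A_def by measurable
  have eq: "{(n, a). n \<ge> 1 \<and> a \<in> P n \<and> \<bar>x - real a / real n\<bar> < \<Psi> n} = {p. x \<in> A p}" for x
    by (auto simp: A_def)
  have inf: "infinite {p. x \<in> A p} \<longleftrightarrow> (\<forall>m. \<exists>k>m. x \<in> A (prod_decode k))" for x
  proof -
    have "{p. x \<in> A p} = prod_decode ` {k. x \<in> A (prod_decode k)}"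
      by (auto simp: image_iff) (metis prod_encode_inverse)+
    then have "finite {p. x \<in> A p} \<longleftrightarrow> finite {k. x \<in> A (prod_decode k)}"
      by (metis finite_image_iff inj_prod_decode)
    then show ?thesis by (simp add: infinite_nat_iff_unbounded)
  qed
  have "W P \<Psi> = {0..1} \<inter> (\<Inter>m. \<Union>k\<in>{m<..}. A (prod_decode k))"
    unfolding W_def eq inf by auto
  also have "\<dots> \<in> sets borel" by measurable
  finally show ?thesis .
qed

end

theory Submission imports Defs begin

text \<open>The convergence case is the Borel--Cantelli lemma and holds for every \<open>P\<close>.

  For divergence, group the denominators into blocks \<open>M^(k+1) < n \<le> M^(k+2)\<close> and cut \<open>(0,1]\<close> into
  \<open>m k\<close> cells of equal length, \<open>m k\<close> being comparable to the number of fractions in the block. The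
  events that two different cells contain no fraction \<open>a/n\<close> with \<open>a \<in> P n\<close> and \<open>n\<close> in the block
  are negatively correlated, so by Chebyshev's inequality and Borel--Cantelli, almost surely a
  proportion \<open>\<kappa>\<close> of the subcells of every fixed cell is eventually occupied. This is a countable
  family of conditions on \<open>P\<close> that does not mention \<open>\<Psi>\<close>.

  For such \<open>P\<close> and a divergent \<open>\<Psi>\<close>, keep in each occupied cell one interval of points close to
  a fraction. A second moment bound gives the limsup of these unions at least the proportion
  \<open>\<kappa>\<^sup>2 / 2\<close> of every cell, and a set with this property has full measure.

  If the average order of \<open>f\<close> is bounded, every cell is long compared with the spacing of the
  fractions of each single denominator. If it is at least linear, a cell contains at most one
  rational point; the fractions of small reduced denominator, which could have large
  multiplicity, are few, and the remaining ones have bounded multiplicity.\<close>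

section \<open>Cells and full measure\<close>

text \<open>Half-open on the left, so that the cells with \<open>j < m\<close> partition the
  interval (0,1], which contains every \<open>a / n\<close> with \<open>1 <= a <= n\<close>.\<close>

definition cell :: "nat \<Rightarrow> nat \<Rightarrow> real set" where
  "cell m j = {real j / real m <.. real (Suc j) / real m}"

lemma cell_lmeasurable [simp]: "cell m j \<in> lmeasurable"
  unfolding cell_def by (rule bounded_set_imp_lmeasurable) auto

lemma cell_borel [measurable]: "cell m j \<in> sets borel"
  unfolding cell_def by simp

lemma measure_cell: "measure lebesgue (cell m j) = 1 / real m"
proof (cases "m = 0")
  case False
  have "real j / real m \<le> real (Suc j) / real m"
    by (intro divide_right_mono) auto
  then have "measure lebesgue (cell m j) = real (Suc j) / real m - real j / real m"
    unfolding cell_def by (simp del: of_nat_Suc)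
  then show ?thesis by (simp add: add_divide_distrib)
qed (simp add: cell_def)

lemma mem_cell_iff:
  assumes "m > 0"
  shows "x \<in> cell m j \<longleftrightarrow> real j < x * real m \<and> x * real m \<le> real j + 1"
  using assms unfolding cell_def by (auto simp: field_simps)

lemma cell_unique:
  assumes "m > 0" "x \<in> cell m i" "x \<in> cell m j"
  shows "i = j"
proof -
  have "real i < real j + 1" "real j < real i + 1"
    using assms by (auto simp: mem_cell_iff)
  then show ?thesis by linarith
qed

lemma cell_cover:
  assumes "m > 0" "x \<in> {0<..1}"
  obtains i where "i < m" "x \<in> cell m i"
proof -
  define c where "c = \<lceil>x * real m\<rceil>"
  have "0 < x * real m" "x * real m \<le> real m"
    using assms by (auto simp: mult_left_le_one_le)
  then have "c \<ge> 1" "c \<le> int m"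
    unfolding c_def by linarith+
  moreover have "real_of_int c - 1 < x * real m" "x * real m \<le> real_of_int c"
    unfolding c_def by linarith+
  ultimately have "nat (c - 1) < m" "x \<in> cell m (nat (c - 1))"
    using assms(1) by (auto simp: mem_cell_iff)
  then show ?thesis using that by blast
qed

lemma cell_subset_unit:
  assumes "i < m"
  shows "cell m i \<subseteq> {0<..1}"
proof -
  have "real (Suc i) / real m \<le> 1" "0 \<le> real i / real m"
    using assms by (auto simp: field_simps)
  then have "x \<in> {0<..1}" if "x \<in> cell m i" for x
    using that le_less_trans[of 0 "real i / real m" x] order_trans[of x "real (Suc i) / real m" 1]
    unfolding cell_def by (simp del: of_nat_Suc)
  then show ?thesis by blast
qed

lemma measure_disjoint_UN_fmeasurable:
  assumes "finite I" "\<And>i. i \<in> I \<Longrightarrow> A i \<in> fmeasurable M" "disjoint_family_on A I"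
  shows "measure M (\<Union>i\<in>I. A i) = (\<Sum>i\<in>I. measure M (A i))"
  using assms by (intro measure_finite_Union) (auto simp: fmeasurableD2)

text \<open>A density argument with cells in place of balls. The complement \<open>A\<close> lies
  between a compact \<open>K\<close> and an open \<open>U\<close>, with small differences. Fine
  cells that meet \<open>K\<close> stay inside \<open>U\<close>, and \<open>S\<close> fills a
  proportion \<open>c\<close> of each of them, yet the part of \<open>S\<close> in \<open>U\<close>
  lies in \<open>U - A\<close>. So these cells have small total measure, and with them
  \<open>A\<close>.\<close>

lemma emeasure_eq_1_of_cells:
  assumes S: "S \<in> sets borel" "S \<subseteq> {0..1}"
    and m: "\<And>r. m r > 0" "filterlim m at_top sequentially"
    and c: "c > 0" "\<And>r i. i < m r \<Longrightarrow> c / real (m r) \<le> measure lebesgue (S \<inter> cell (m r) i)"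
  shows "emeasure lebesgue S = 1"
proof -
  define A where "A = {0<..1} - S"
  have Sl: "S \<in> lmeasurable"
    using S by (intro bounded_set_imp_lmeasurable) (auto intro: bounded_subset[OF bounded_closed_interval])
  have Al: "A \<in> lmeasurable"
    unfolding A_def using Sl by (intro fmeasurable.Diff bounded_set_imp_lmeasurable) auto
  have bound: "measure lebesgue A \<le> e / c + e" if e: "e > 0" for e
  proof -
    obtain K where K: "closed K" "K \<subseteq> A" "A - K \<in> lmeasurable" "emeasure lebesgue (A - K) < ennreal e"
      by (rule sets_lebesgue_inner_closed[OF fmeasurableD[OF Al] e])
    obtain U where U: "open U" "A \<subseteq> U" "U - A \<in> lmeasurable" "emeasure lebesgue (U - A) < ennreal e"
      by (rule sets_lebesgue_outer_open[OF fmeasurableD[OF Al] e])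
    have "bounded K"
      by (rule bounded_subset[OF bounded_closed_interval[of 0 1]]) (use K(2) in \<open>auto simp: A_def\<close>)
    then have "compact K" using K(1) by (simp add: compact_eq_bounded_closed)
    moreover have "K \<subseteq> U" using K(2) U(2) by blast
    ultimately obtain \<delta> where \<delta>: "\<delta> > 0" "(\<Union>x\<in>K. ball x \<delta>) \<subseteq> U"
      using compact_subset_open_imp_ball_epsilon_subset[of K U] U(1) by blast
    have "eventually (\<lambda>r. m r \<ge> nat \<lceil>1 / \<delta>\<rceil> + 1) sequentially"
      using m(2) by (simp add: filterlim_at_top)
    then obtain r where "m r \<ge> nat \<lceil>1 / \<delta>\<rceil> + 1" by (auto simp: eventually_sequentially)
    then have "1 / \<delta> < real (m r)" by linarith
    then have r: "1 / real (m r) < \<delta>" using \<delta>(1) m(1)[of r] by (simp add: field_simps)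
    define J where "J = {i. i < m r \<and> cell (m r) i \<inter> K \<noteq> {}}"
    define V where "V = (\<Union>i\<in>J. cell (m r) i)"
    have fJ: "finite J" unfolding J_def by auto
    have disj: "disjoint_family_on (cell (m r)) J"
      unfolding disjoint_family_on_def using cell_unique[OF m(1)] by blast
    have KV: "K \<subseteq> V"
    proof
      fix x assume x: "x \<in> K"
      then have "x \<in> {0<..1}" using K(2) A_def by auto
      then obtain i where "i < m r" "x \<in> cell (m r) i" using cell_cover[OF m(1)] by blast
      then show "x \<in> V" using x unfolding V_def J_def by auto
    qed
    have VU: "V \<subseteq> U"
    proof
      fix x assume "x \<in> V"
      then obtain i y where i: "x \<in> cell (m r) i" "y \<in> cell (m r) i" "y \<in> K"
        unfolding V_def J_def by auto
      have "\<bar>y * real (m r) - x * real (m r)\<bar> < 1"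
        using i(1,2) m(1)[of r] by (auto simp: mem_cell_iff)
      then have "\<bar>y - x\<bar> < 1 / real (m r)"
        using m(1)[of r] by (simp add: pos_less_divide_eq abs_mult flip: left_diff_distrib)
      then have "x \<in> ball y \<delta>" using r by (auto simp: dist_real_def)
      then show "x \<in> U" using \<delta>(2) i(3) by blast
    qed
    have Vl: "V \<in> lmeasurable" unfolding V_def using fJ by (intro fmeasurable.finite_UN) auto
    have "measure lebesgue V = (\<Sum>i\<in>J. measure lebesgue (cell (m r) i))"
      unfolding V_def using fJ disj by (intro measure_disjoint_UN_fmeasurable) auto
    then have "c * measure lebesgue V = (\<Sum>i\<in>J. c / real (m r))"
      by (simp add: measure_cell)
    also have "\<dots> \<le> (\<Sum>i\<in>J. measure lebesgue (S \<inter> cell (m r) i))"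
      by (intro sum_mono c(2)) (auto simp: J_def)
    also have "\<dots> = measure lebesgue (\<Union>i\<in>J. S \<inter> cell (m r) i)"
      using fJ disj Sl by (intro measure_disjoint_UN_fmeasurable[symmetric] fmeasurable.Int)
        (auto simp: disjoint_family_on_def)
    also have "\<dots> \<le> measure lebesgue (U - A)"
    proof (rule measure_mono_fmeasurable)
      show "(\<Union>i\<in>J. S \<inter> cell (m r) i) \<subseteq> U - A"
        using VU unfolding V_def A_def by auto
      show "(\<Union>i\<in>J. S \<inter> cell (m r) i) \<in> sets lebesgue"
        using fJ Sl by (intro sets.finite_UN) auto
    qed (rule U(3))
    also have "\<dots> \<le> e"
      using U(3,4) that by (simp add: emeasure_eq_measure2 ennreal_less_iff)
    finally have "measure lebesgue V \<le> e / c"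
      using c(1) by (simp add: field_simps)
    moreover have "measure lebesgue A \<le> measure lebesgue (V \<union> (A - K))"
      using KV K(3) Vl Al by (intro measure_mono_fmeasurable) auto
    moreover have "\<dots> \<le> measure lebesgue V + measure lebesgue (A - K)"
      using Vl K(3) by (intro measure_Un_le) auto
    moreover have "measure lebesgue (A - K) \<le> e"
      using K(3,4) that by (simp add: emeasure_eq_measure2 ennreal_less_iff)
    ultimately show ?thesis by linarith
  qed
  have "measure lebesgue A \<le> 0"
  proof (rule field_le_epsilon)
    fix e :: real assume e: "e > 0"
    define d where "d = 1 / c + 1"
    have d: "d > 0" unfolding d_def using c(1) by (simp add: add_pos_pos)
    have "e / d / c + e / d = e / d * d" by (simp add: d_def distrib_left del: nonzero_mult_div_cancel_right)
    then show "measure lebesgue A \<le> 0 + e"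
      using bound[of "e / d"] e d by simp
  qed
  then have A0: "measure lebesgue A = 0" by (simp add: measure_le_0_iff)
  have "1 = measure lebesgue {0<..1::real}" by simp
  also have "\<dots> \<le> measure lebesgue (S \<union> A)"
    using Sl Al by (intro measure_mono_fmeasurable fmeasurable.Un) (auto simp: A_def)
  also have "\<dots> \<le> measure lebesgue S + measure lebesgue A"
    using Sl Al by (intro measure_Un_le) auto
  finally have "1 \<le> measure lebesgue S" using A0 by simp
  moreover have "measure lebesgue S \<le> measure lebesgue {0..1::real}"
    using S Sl by (intro measure_mono_fmeasurable) auto
  ultimately have "measure lebesgue S = 1" by simp
  then show ?thesis using Sl by (simp add: emeasure_eq_measure2)
qed

section \<open>Second moment bounds for unions and limsup sets\<close>

text \<open>Let \<open>s\<close> be the number of sets \<open>E k\<close> containing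
  \<open>x\<close>. Expanding \<open>(c * s - 1)^2 >= 0\<close> gives
  \<open>2 * c * s - c^2 * s^2 <= 1\<close>, and the left side vanishes for \<open>s = 0\<close>;
  integrate. The best \<open>c\<close> yields the Chung-Erdos inequality, and a free
  \<open>c\<close> avoids dividing by the second moment.\<close>

lemma measure_UN_second_moment:
  assumes "finite I" "\<And>k. k \<in> I \<Longrightarrow> E k \<in> fmeasurable M"
  shows "2 * c * (\<Sum>k\<in>I. measure M (E k)) - c\<^sup>2 * (\<Sum>k\<in>I. \<Sum>l\<in>I. measure M (E k \<inter> E l))
    \<le> measure M (\<Union>k\<in>I. E k)"
proof -
  let ?i = "\<lambda>A x. indicator A x :: real"
  let ?g = "\<lambda>x. 2 * c * (\<Sum>k\<in>I. ?i (E k) x) - c\<^sup>2 * (\<Sum>k\<in>I. \<Sum>l\<in>I. ?i (E k \<inter> E l) x)"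
  have int: "integrable M (?i A)" if "A \<in> fmeasurable M" for A
    using that by (auto simp: fmeasurable_def)
  have int1 [simp]: "integrable M (?i (E k))" if "k \<in> I" for k
    using that assms by (intro int) auto
  have int2 [simp]: "integrable M (?i (E k \<inter> E l))" if "k \<in> I" "l \<in> I" for k l
    using that assms by (intro int fmeasurable.Int) auto
  have int3 [simp]: "integrable M (?i (\<Union>k\<in>I. E k))"
    using assms by (intro int fmeasurable.finite_UN) auto
  have m: "integral\<^sup>L M (?i A) = measure M A" if "A \<in> fmeasurable M" for A
    using that by (simp add: fmeasurable_def Int_absorb2 sets.sets_into_space)
  have "integral\<^sup>L M ?g \<le> integral\<^sup>L M (?i (\<Union>k\<in>I. E k))"
  proof (rule integral_mono)
    show "integrable M ?g"
      by (intro Bochner_Integration.integrable_diff integrable_mult_right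
          Bochner_Integration.integrable_sum) auto
    fix x
    let ?s = "\<Sum>k\<in>I. ?i (E k) x"
    have s2: "(\<Sum>k\<in>I. \<Sum>l\<in>I. ?i (E k \<inter> E l) x) = ?s * ?s"
      by (simp add: sum_product indicator_inter_arith)
    show "?g x \<le> ?i (\<Union>k\<in>I. E k) x"
    proof (cases "x \<in> (\<Union>k\<in>I. E k)")
      case True
      have "0 \<le> (c * ?s - 1)\<^sup>2" by simp
      then show ?thesis using True by (simp add: s2 power2_eq_square algebra_simps)
    next
      case False
      then have "?s = 0" by (intro sum.neutral) auto
      then show ?thesis by (simp add: s2)
    qed
  qed auto
  also have "integral\<^sup>L M ?g = 2 * c * (\<Sum>k\<in>I. integral\<^sup>L M (?i (E k)))
      - c\<^sup>2 * (\<Sum>k\<in>I. \<Sum>l\<in>I. integral\<^sup>L M (?i (E k \<inter> E l)))"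
    by (subst Bochner_Integration.integral_diff)
      (auto simp: Bochner_Integration.integral_sum intro!: integrable_mult_right Bochner_Integration.integrable_sum)
  also have "\<dots> = 2 * c * (\<Sum>k\<in>I. measure M (E k)) - c\<^sup>2 * (\<Sum>k\<in>I. \<Sum>l\<in>I. measure M (E k \<inter> E l))"
    using assms by (simp add: m fmeasurable.Int cong: sum.cong)
  also have "integral\<^sup>L M (?i (\<Union>k\<in>I. E k)) = measure M (\<Union>k\<in>I. E k)"
    using assms by (intro m fmeasurable.finite_UN) auto
  finally show ?thesis .
qed

text \<open>Continuity from above along the decreasing tails, with \<open>B\<close> supplying finite
  measure. A finite stretch of each tail suffices, so the second moment bound can be used with
  finite sums.\<close>

lemma measure_limsup_ge:
  fixes E :: "nat \<Rightarrow> 'a set"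
  assumes E: "\<And>k. E k \<in> sets M" "\<And>k. E k \<subseteq> B" and B: "B \<in> fmeasurable M"
    and ge: "\<And>n. \<exists>N. d \<le> measure M (\<Union>k\<in>{n..N}. E k)"
  shows "d \<le> measure M (\<Inter>n. \<Union>k\<in>{n..}. E k)"
proof -
  define U where "U n = (\<Union>k\<in>{n..}. E k)" for n
  have Us: "U n \<in> sets M" for n unfolding U_def using E(1) by (intro sets.countable_UN'') auto
  have Uf: "U n \<in> fmeasurable M" for n
    using fmeasurableI2[OF B _ Us, of n] E(2) by (auto simp: U_def)
  have "decseq U" unfolding U_def decseq_def by (intro allI impI UN_mono) auto
  then have "(\<lambda>n. measure M (U n)) \<longlonglongrightarrow> measure M (\<Inter>n. U n)"
    using Us Uf by (intro Lim_measure_decseq) (auto simp: fmeasurable_def less_top)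
  moreover have "d \<le> measure M (U n)" for n
  proof -
    obtain N where "d \<le> measure M (\<Union>k\<in>{n..N}. E k)" using ge by blast
    also have "\<dots> \<le> measure M (U n)"
      using E(1) Uf by (intro measure_mono_fmeasurable) (auto simp: U_def)
    finally show ?thesis .
  qed
  ultimately have "d \<le> measure M (\<Inter>n. U n)" by (intro LIMSEQ_le_const) auto
  then show ?thesis unfolding U_def .
qed

text \<open>The assumption \<open>x <= y + 1\<close> keeps the bound nonnegative when the interval
  is empty.\<close>

lemma card_nat_in_interval:
  fixes x y :: real
  assumes "x \<le> y + 1"
  shows "finite {j::nat. x \<le> real j \<and> real j \<le> y}"
    and "real (card {j::nat. x \<le> real j \<and> real j \<le> y}) \<le> y - x + 1"
proof -
  have sub: "{j::nat. x \<le> real j \<and> real j \<le> y} \<subseteq> nat ` {\<lceil>x\<rceil>..\<lfloor>y\<rfloor>}"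
  proof
    fix j :: nat assume "j \<in> {j::nat. x \<le> real j \<and> real j \<le> y}"
    then have "int j \<in> {\<lceil>x\<rceil>..\<lfloor>y\<rfloor>}" "j = nat (int j)" by (auto simp: ceiling_le_iff le_floor_iff)
    then show "j \<in> nat ` {\<lceil>x\<rceil>..\<lfloor>y\<rfloor>}" by blast
  qed
  then show "finite {j::nat. x \<le> real j \<and> real j \<le> y}"
    by (rule finite_subset) auto
  have "card {j::nat. x \<le> real j \<and> real j \<le> y} \<le> card (nat ` {\<lceil>x\<rceil>..\<lfloor>y\<rfloor>})"
    using sub by (intro card_mono) auto
  also have "\<dots> \<le> card {\<lceil>x\<rceil>..\<lfloor>y\<rfloor>}" by (rule card_image_le) auto
  finally have "real (card {j::nat. x \<le> real j \<and> real j \<le> y}) \<le> real (nat (\<lfloor>y\<rfloor> - \<lceil>x\<rceil> + 1))"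
    by simp
  also have "\<dots> \<le> y - x + 1" using assms by linarith
  finally show "real (card {j::nat. x \<le> real j \<and> real j \<le> y}) \<le> y - x + 1" .
qed

section \<open>The limsup of sparse unions of intervals\<close>

lemma open_interval_lmeasurable [simp]: "{u<..<v::real} \<in> lmeasurable"
  by (rule bounded_set_imp_lmeasurable) auto

lemma open_interval_subset_cell:
  assumes "real j / real m \<le> u" "u + g \<le> real (Suc j) / real m"
  shows "{u<..<u + g} \<subseteq> cell m j"
  using assms unfolding cell_def by (intro subsetI) (simp del: of_nat_Suc)

lemma measure_interval_Int_pieces:
  assumes m: "m > 0" and X: "finite X" and gh: "0 \<le> g" "0 \<le> h"
    and v: "\<And>j. j \<in> X \<Longrightarrow> real j / real m \<le> v j \<and> v j + g \<le> real (Suc j) / real m"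
  shows "measure lebesgue ({u<..<u + h} \<inter> (\<Union>j\<in>X. {v j<..<v j + g})) \<le> (real m * h + 2) * g"
proof -
  \<comment> \<open>Each piece lies in its cell, and a cell that meets the interval has
    \<open>j < x * m <= j + 1\<close> for some \<open>x\<close> between \<open>u\<close> and
    \<open>u + h\<close>. This explains the \<open>- 1\<close>; rounding adds another 1, hence
    \<open>m * h + 2\<close>.\<close>
  define J where "J = {j. u * real m - 1 \<le> real j \<and> real j \<le> (u + h) * real m}"
  have hm: "0 \<le> h * real m" using gh by simp
  have J: "finite J" "real (card J) \<le> real m * h + 2"
    using card_nat_in_interval[of "u * real m - 1" "(u + h) * real m"] hm
    unfolding J_def by (auto simp: algebra_simps)
  have sub: "{u<..<u + h} \<inter> (\<Union>j\<in>X. {v j<..<v j + g}) \<subseteq> (\<Union>j\<in>J \<inter> X. {v j<..<v j + g})"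
  proof
    fix x assume x: "x \<in> {u<..<u + h} \<inter> (\<Union>j\<in>X. {v j<..<v j + g})"
    then obtain j where j: "j \<in> X" "x \<in> {v j<..<v j + g}" by blast
    then have "x \<in> cell m j" using open_interval_subset_cell v by blast
    then have "real j < x * real m" "x * real m \<le> real j + 1" using mem_cell_iff[OF m] by auto
    moreover have "u * real m < x * real m" "x * real m < (u + h) * real m"
      using x m by auto
    ultimately have "j \<in> J" unfolding J_def by auto
    then show "x \<in> (\<Union>j\<in>J \<inter> X. {v j<..<v j + g})" using j by blast
  qed
  have "measure lebesgue ({u<..<u + h} \<inter> (\<Union>j\<in>X. {v j<..<v j + g}))
      \<le> measure lebesgue (\<Union>j\<in>J \<inter> X. {v j<..<v j + g})"
    using X J(1) by (intro measure_mono_fmeasurable[OF sub] fmeasurable.finite_UN)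
      (auto intro!: fmeasurableD fmeasurable.Int fmeasurable.finite_UN)
  also have "\<dots> \<le> (\<Sum>j\<in>J \<inter> X. measure lebesgue {v j<..<v j + g})"
    using J(1) by (intro measure_UNION_le) auto
  also have "\<dots> = real (card (J \<inter> X)) * g" using gh by simp
  also have "\<dots> \<le> real (card J) * g"
    using J(1) gh by (intro mult_right_mono) (auto intro: card_mono)
  also have "\<dots> \<le> (real m * h + 2) * g" using J(2) gh by (intro mult_right_mono) auto
  finally show ?thesis .
qed

lemma sum_half_powers_le:
  "(\<Sum>k\<in>{n..N}. if k \<le> l then (1/2)^(l - k) else 0 :: real) \<le> 2"
proof -
  have *: "(\<Sum>k\<le>l. (1/2)^(l - k) :: real) \<le> 2"
  proof (induction l)
    case (Suc l)
    have "(\<Sum>k\<le>Suc l. (1/2)^(Suc l - k) :: real) = 1 + (\<Sum>k\<le>l. (1/2) * (1/2)^(l - k))"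
      by (simp add: Suc_diff_le)
    also have "\<dots> = 1 + (1/2) * (\<Sum>k\<le>l. (1/2)^(l - k))" by (simp only: sum_distrib_left)
    finally show ?case using Suc by simp
  qed simp
  have "(\<Sum>k\<in>{n..N}. if k \<le> l then (1/2)^(l - k) else 0 :: real)
      = (\<Sum>k\<in>{n..N} \<inter> {..l}. (1/2)^(l - k))"
    by (subst sum.inter_restrict) (auto intro: sum.cong)
  also have "\<dots> \<le> (\<Sum>k\<le>l. (1/2)^(l - k))" by (intro sum_mono2) auto
  finally show ?thesis using * by linarith
qed

lemma lacunary_ratio:
  fixes m :: "nat \<Rightarrow> nat"
  assumes "\<And>k. m k > 0" "\<And>k. 2 * m k \<le> m (Suc k)" "k \<le> l"
  shows "real (m k) / real (m l) \<le> (1/2)^(l - k)"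
proof -
  have "2 ^ d * m k \<le> m (k + d)" for d
  proof (induction d)
    case (Suc d)
    then show ?case using assms(2)[of "k + d"] by simp
  qed simp
  from this[of "l - k"] have "2 ^ (l - k) * m k \<le> m l" using assms(3) by simp
  then have "real (2 ^ (l - k) * m k) \<le> real (m l)" by (rule of_nat_mono)
  then show ?thesis using assms(1)[of l] by (simp add: field_simps)
qed

text \<open>Distinct scales \<open>k < l\<close> are nearly independent: an interval of length \<open>h k\<close> meets at most
  \<open>m l * h k + 2\<close> cells of level \<open>l\<close>, and the error coming from the \<open>2\<close> decays geometrically in
  \<open>l - k\<close>.\<close>

lemma measure_limsup_pieces:
  fixes m :: "nat \<Rightarrow> nat" and X :: "nat \<Rightarrow> nat set" and u :: "nat \<Rightarrow> nat \<Rightarrow> real"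
  assumes m: "\<And>k. m k > 0" "\<And>k. 2 * m k \<le> m (Suc k)"
    and h: "\<And>k. 0 \<le> h k" "\<And>k. h k * real (m k) \<le> 1" "\<not> summable (\<lambda>k. h k * real (m k))"
    and X: "\<And>k. X k \<subseteq> {..<m k}" "\<And>k. real (card (X k)) \<le> b * real (m k)"
      "\<forall>\<^sub>F k in sequentially. \<kappa> * b * real (m k) \<le> real (card (X k))"
    and u: "\<And>k j. j \<in> X k \<Longrightarrow> real j / real (m k) \<le> u k j \<and> u k j + h k \<le> real (Suc j) / real (m k)"
    and pos: "\<kappa> > 0" "b > 0"
  shows "\<kappa>\<^sup>2 * b / 2 \<le> measure lebesgue (\<Inter>n. \<Union>k\<in>{n..}. \<Union>j\<in>X k. {u k j<..<u k j + h k})"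
proof -
  define E where "E k = (\<Union>j\<in>X k. {u k j<..<u k j + h k})" for k
  \<comment> \<open>\<open>t k\<close> is the share of a cell of level \<open>k\<close> that one
    piece occupies, and \<open>w k l\<close> is the geometric bound for
    \<open>m k / m l\<close>.\<close>
  define t where "t k = h k * real (m k)" for k
  define w :: "nat \<Rightarrow> nat \<Rightarrow> real" where "w k l = (if k \<le> l then (1/2)^(l - k) else 0)" for k l
  have fX: "finite (X k)" for k using X(1) finite_subset by blast
  have t: "0 \<le> t k" "t k \<le> 1" for k unfolding t_def using h by auto
  have sub: "{u k j<..<u k j + h k} \<subseteq> cell (m k) j" if "j \<in> X k" for k j
    using open_interval_subset_cell u[OF that] by blast
  have El: "E k \<in> lmeasurable" for k
    unfolding E_def using fX by (intro fmeasurable.finite_UN) auto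
  have disj: "disjoint_family_on (\<lambda>j. {u k j<..<u k j + h k}) (X k)" for k
    unfolding disjoint_family_on_def using sub cell_unique[OF m(1)] by blast
  have mE: "measure lebesgue (E k) = real (card (X k)) * h k" for k
    unfolding E_def using fX disj h by (subst measure_disjoint_UN_fmeasurable) auto
  have mE_le: "measure lebesgue (E k) \<le> b * t k" for k
    unfolding mE t_def using mult_right_mono[OF X(2) h(1)] by (simp add: ac_simps)
  have inter: "measure lebesgue (E k \<inter> E l) \<le> b * t k * t l + 2 * b * w k l * t l" if "k < l" for k l
  proof -
    have "E k \<inter> E l = (\<Union>j\<in>X k. {u k j<..<u k j + h k} \<inter> E l)" unfolding E_def by auto
    also have "measure lebesgue \<dots> \<le> (\<Sum>j\<in>X k. measure lebesgue ({u k j<..<u k j + h k} \<inter> E l))"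
      using fX El by (intro measure_UNION_le fmeasurableD fmeasurable.Int) auto
    also have "\<dots> \<le> (\<Sum>j\<in>X k. (real (m l) * h k + 2) * h l)"
      unfolding E_def using m h fX u by (intro sum_mono measure_interval_Int_pieces) auto
    also have "\<dots> = real (card (X k)) * ((real (m l) * h k + 2) * h l)" by simp
    also have "\<dots> \<le> b * real (m k) * ((real (m l) * h k + 2) * h l)"
      using X(2) h by (intro mult_right_mono) auto
    also have "\<dots> = b * t k * t l + 2 * b * (real (m k) / real (m l)) * t l"
      unfolding t_def using m(1)[of l] by (simp add: field_simps)
    also have "\<dots> \<le> b * t k * t l + 2 * b * w k l * t l"
      using lacunary_ratio[of m k l, OF m] that pos t unfolding w_def
      by (intro add_mono mult_right_mono mult_left_mono) auto
    finally show ?thesis .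
  qed
  have w0: "0 \<le> w k l" for k l unfolding w_def by auto
  \<comment> \<open>Symmetrised so that the double sum needs no case split. On the diagonal
    \<open>w k k = 1\<close>, and the error terms absorb the bound \<open>b * t k\<close> for the
    measure of \<open>E k\<close>.\<close>
  have inter': "measure lebesgue (E k \<inter> E l)
      \<le> b * t k * t l + (2 * b * w k l * t l + 2 * b * w l k * t k)" for k l
  proof (cases k l rule: linorder_cases)
    case less
    have "0 \<le> 2 * b * w l k * t k" using w0 t pos by simp
    then show ?thesis using inter[OF less] by linarith
  next
    case equal
    have "measure lebesgue (E k \<inter> E l) \<le> b * t k" using mE_le equal by simp
    moreover have "0 \<le> b * t k" "0 \<le> b * t k * t l" using t pos by auto
    ultimately show ?thesis using equal by (simp add: w_def)
  next
    case greater
    have "0 \<le> 2 * b * w k l * t l" using w0 t pos by simp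
    then show ?thesis using inter[OF greater] by (simp add: Int_commute mult.commute mult.left_commute)
  qed
  have "\<kappa>\<^sup>2 * b / 2 \<le> measure lebesgue (\<Inter>n. \<Union>k\<in>{n..}. E k)"
  proof (rule measure_limsup_ge)
    show "E k \<in> sets lebesgue" for k using El by auto
    show "E k \<subseteq> {0<..1}" for k
      unfolding E_def using sub cell_subset_unit X(1) by blast
    show "{0<..1::real} \<in> lmeasurable" by (rule bounded_set_imp_lmeasurable) auto
    fix n :: nat
    obtain k1 where k1: "\<And>k. k \<ge> k1 \<Longrightarrow> \<kappa> * b * real (m k) \<le> real (card (X k))"
      using X(3) by (auto simp: eventually_sequentially)
    \<comment> \<open>From \<open>k1\<close> on the lower bound for \<open>card (X k)\<close> is
      available. A sum of at least 8 makes the total error \<open>8 * (b * S)\<close> at most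
      \<open>b * S^2\<close>, so that the main term is at most doubled.\<close>
    define n' where "n' = max n k1"
    have "\<exists>N. 8 \<le> (\<Sum>k\<in>{n'..N}. t k)"
    proof (rule ccontr)
      assume "\<not> ?thesis"
      then have *: "(\<Sum>k\<in>{n'..N}. t k) \<le> 8" for N by (meson linear)
      have "summable t"
      proof (rule bounded_imp_summable)
        fix N
        have "(\<Sum>k\<le>N. t k) \<le> (\<Sum>k\<in>{..<n'} \<union> {n'..N}. t k)"
          using t by (intro sum_mono2) auto
        also have "\<dots> = (\<Sum>k<n'. t k) + (\<Sum>k\<in>{n'..N}. t k)"
          by (rule sum.union_disjoint) auto
        finally show "(\<Sum>k\<le>N. t k) \<le> (\<Sum>k<n'. t k) + 8" using *[of N] by linarith
      qed (rule t)
      then show False using h(3) unfolding t_def by simp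
    qed
    then obtain N where N: "8 \<le> (\<Sum>k\<in>{n'..N}. t k)" by blast
    define S where "S = (\<Sum>k\<in>{n'..N}. t k)"
    have S8: "8 \<le> S" using N unfolding S_def .
    have low: "\<kappa> * b * S \<le> (\<Sum>k\<in>{n'..N}. measure lebesgue (E k))"
      unfolding S_def sum_distrib_left
    proof (rule sum_mono)
      fix k assume "k \<in> {n'..N}"
      then have "\<kappa> * b * real (m k) * h k \<le> real (card (X k)) * h k"
        using k1[of k] h by (intro mult_right_mono) (auto simp: n'_def)
      then show "\<kappa> * b * t k \<le> measure lebesgue (E k)" unfolding mE t_def by (simp add: ac_simps)
    qed
    have cross: "(\<Sum>k\<in>{n'..N}. \<Sum>l\<in>{n'..N}. 2 * b * w k l * t l) \<le> 4 * b * S"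
    proof -
      have "(\<Sum>k\<in>{n'..N}. \<Sum>l\<in>{n'..N}. 2 * b * w k l * t l) = (\<Sum>l\<in>{n'..N}. \<Sum>k\<in>{n'..N}. 2 * b * t l * w k l)"
        by (subst sum.swap) (simp add: ac_simps)
      also have "\<dots> = (\<Sum>l\<in>{n'..N}. 2 * b * t l * (\<Sum>k\<in>{n'..N}. w k l))"
        by (simp only: sum_distrib_left)
      also have "\<dots> \<le> (\<Sum>l\<in>{n'..N}. 2 * b * t l * 2)"
        using sum_half_powers_le pos t unfolding w_def by (intro sum_mono mult_left_mono) auto
      also have "\<dots> = 4 * b * S" unfolding S_def sum_distrib_left by (simp add: ac_simps)
      finally show ?thesis .
    qed
    have "(\<Sum>k\<in>{n'..N}. \<Sum>l\<in>{n'..N}. measure lebesgue (E k \<inter> E l))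
        \<le> (\<Sum>k\<in>{n'..N}. \<Sum>l\<in>{n'..N}. b * t k * t l + (2 * b * w k l * t l + 2 * b * w l k * t k))"
      by (intro sum_mono inter')
    also have "\<dots> = (\<Sum>k\<in>{n'..N}. \<Sum>l\<in>{n'..N}. b * t k * t l)
        + ((\<Sum>k\<in>{n'..N}. \<Sum>l\<in>{n'..N}. 2 * b * w k l * t l)
         + (\<Sum>k\<in>{n'..N}. \<Sum>l\<in>{n'..N}. 2 * b * w l k * t k))"
      by (simp only: sum.distrib)
    also have "(\<Sum>k\<in>{n'..N}. \<Sum>l\<in>{n'..N}. 2 * b * w l k * t k)
        = (\<Sum>k\<in>{n'..N}. \<Sum>l\<in>{n'..N}. 2 * b * w k l * t l)"
      by (rule sum.swap)
    also have "(\<Sum>k\<in>{n'..N}. \<Sum>l\<in>{n'..N}. b * t k * t l) = b * (S * S)"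
      unfolding S_def sum_product by (simp add: sum_distrib_left ac_simps)
    finally have up: "(\<Sum>k\<in>{n'..N}. \<Sum>l\<in>{n'..N}. measure lebesgue (E k \<inter> E l)) \<le> 2 * b * S\<^sup>2"
    proof -
      assume "(\<Sum>k\<in>{n'..N}. \<Sum>l\<in>{n'..N}. measure lebesgue (E k \<inter> E l)) \<le> b * (S * S)
        + ((\<Sum>k\<in>{n'..N}. \<Sum>l\<in>{n'..N}. 2 * b * w k l * t l)
         + (\<Sum>k\<in>{n'..N}. \<Sum>l\<in>{n'..N}. 2 * b * w k l * t l))"
      also have "\<dots> \<le> b * (S * S) + 8 * (b * S)" using cross by linarith
      also have "8 * (b * S) \<le> S * (b * S)" using S8 pos by (intro mult_right_mono) auto
      finally show ?thesis by (simp add: power2_eq_square ac_simps)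
    qed
    \<comment> \<open>This value maximises
      \<open>2 * c * (\<kappa> * b * S) - c^2 * (2 * b * S^2)\<close>.\<close>
    define c where "c = \<kappa> / (2 * S)"
    have c: "0 < c" unfolding c_def using pos S8 by simp
    have "\<kappa>\<^sup>2 * b / 2 = 2 * c * (\<kappa> * b * S) - c\<^sup>2 * (2 * b * S\<^sup>2)"
      unfolding c_def using S8 by (simp add: field_simps power2_eq_square)
    also have "\<dots> \<le> 2 * c * (\<Sum>k\<in>{n'..N}. measure lebesgue (E k))
        - c\<^sup>2 * (\<Sum>k\<in>{n'..N}. \<Sum>l\<in>{n'..N}. measure lebesgue (E k \<inter> E l))"
      using low up c by (intro diff_mono mult_left_mono) auto
    also have "\<dots> \<le> measure lebesgue (\<Union>k\<in>{n'..N}. E k)"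
      using El by (intro measure_UN_second_moment) auto
    also have "\<dots> \<le> measure lebesgue (\<Union>k\<in>{n..N}. E k)"
      using El by (intro measure_mono_fmeasurable fmeasurable.finite_UN)
        (auto simp: n'_def intro!: fmeasurableD)
    finally show "\<exists>N. \<kappa>\<^sup>2 * b / 2 \<le> measure lebesgue (\<Union>k\<in>{n..N}. E k)" by blast
  qed
  then show ?thesis unfolding E_def .
qed

section \<open>Random subsets avoiding prescribed sets\<close>

text \<open>For \<open>0 < N\<close> and \<open>q <= N\<close> this is the ratio of
  \<open>(N - 1) choose q\<close> to \<open>N choose q\<close>. The truncation at 0 keeps all
  factors nonnegative when \<open>N\<close> drops below \<open>q\<close>, so that products can be
  compared factor by factor. At \<open>N = 0\<close> the value is 1 by default, which breaks
  monotonicity there.\<close>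

definition shrink_factor :: "nat \<Rightarrow> nat \<Rightarrow> real" where
  "shrink_factor q N = max 0 (1 - real q / real N)"

lemma choose_pred_eq:
  assumes "N > 0"
  shows "real ((N - 1) choose q) = real (N choose q) * shrink_factor q N"
proof -
  have "real (N - q) * real (N choose q) = real N * real ((N - 1) choose q)"
    using binomial_absorb_comp[of N q] by (metis of_nat_mult)
  moreover have "real (N - q) = real N * shrink_factor q N"
    using assms unfolding shrink_factor_def by (cases "q \<le> N") (auto simp: max_def field_simps of_nat_diff)
  ultimately show ?thesis using assms by (simp add: ac_simps)
qed

lemma choose_diff_eq:
  "s \<le> n \<Longrightarrow> real ((n - s) choose q) = real (n choose q) * (\<Prod>i<s. shrink_factor q (n - i))"
proof (induction s)
  case (Suc s)
  then show ?case using choose_pred_eq[of "n - s" q] by simp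
qed simp

lemma shrink_factor_nonneg: "0 \<le> shrink_factor q N"
  unfolding shrink_factor_def by simp

lemma shrink_factor_mono:
  assumes "0 < N" "N \<le> N'"
  shows "shrink_factor q N \<le> shrink_factor q N'"
  using assms unfolding shrink_factor_def by (intro max.mono) (auto simp: frac_le)

text \<open>The left side is the probability that a uniform \<open>q\<close>-subset of
  \<open>n\<close> points misses \<open>s\<close> given points. Exposing these points one at a time,
  each factor is at most \<open>1 - q / n\<close>, hence at most
  \<open>exp (- (q / n))\<close>.\<close>

lemma choose_diff_ratio_le_exp:
  assumes "s \<le> n" "q \<le> n"
  shows "real ((n - s) choose q) / real (n choose q) \<le> exp (- (real q / real n * real s))"
proof -
  have pos: "real (n choose q) > 0" using assms by simp
  have "(\<Prod>i<s. shrink_factor q (n - i)) \<le> (\<Prod>i<s. exp (- (real q / real n)))"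
  proof (rule prod_mono, intro conjI shrink_factor_nonneg)
    fix i assume "i \<in> {..<s}"
    then have "shrink_factor q (n - i) \<le> shrink_factor q n"
      using assms by (intro shrink_factor_mono) auto
    also have "\<dots> \<le> exp (- (real q / real n))"
      unfolding shrink_factor_def using exp_ge_add_one_self[of "- (real q / real n)"] by simp
    finally show "shrink_factor q (n - i) \<le> exp (- (real q / real n))" .
  qed
  also have "\<dots> = exp (- (real q / real n * real s))"
    by (simp add: exp_of_nat_mult[symmetric] ac_simps)
  finally show ?thesis using choose_diff_eq[OF assms(1), of q] pos by simp
qed

text \<open>A subset known to miss \<open>s\<close> points has only \<open>n - s\<close> places
  left, so it is less likely to miss \<open>t\<close> further ones.\<close>

lemma choose_diff_negative_correlation:
  assumes "s + t \<le> n" "q \<le> n"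
  shows "real ((n - (s + t)) choose q) / real (n choose q)
    \<le> real ((n - s) choose q) / real (n choose q) * (real ((n - t) choose q) / real (n choose q))"
proof -
  have pos: "real (n choose q) > 0" using assms by simp
  have "(\<Prod>i<t. shrink_factor q (n - s - i)) \<le> (\<Prod>i<t. shrink_factor q (n - i))"
    using assms by (intro prod_mono conjI shrink_factor_nonneg shrink_factor_mono) auto
  then have "real ((n - s) choose q) * (\<Prod>i<t. shrink_factor q (n - s - i)) / real (n choose q)
     \<le> real ((n - s) choose q) * (\<Prod>i<t. shrink_factor q (n - i)) / real (n choose q)"
    using pos by (intro divide_right_mono mult_left_mono) auto
  moreover have "real ((n - (s + t)) choose q) = real ((n - s) choose q) * (\<Prod>i<t. shrink_factor q (n - s - i))"
    using choose_diff_eq[of t "n - s" q] assms by simp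
  moreover have "real ((n - t) choose q) / real (n choose q) = (\<Prod>i<t. shrink_factor q (n - i))"
    using choose_diff_eq[of t n q] assms pos by simp
  ultimately show ?thesis by simp
qed

section \<open>Avoidance events in the product measure\<close>

lemma measure_P_n_disjoint:
  assumes "0 \<le> f n" "f n \<le> int n" "S \<subseteq> {1..n}"
  shows "measure (P_n f n) {Q \<in> Omega_n f n. Q \<inter> S = {}}
    = real ((n - card S) choose nat (f n)) / real (n choose nat (f n))"
proof -
  have fS: "finite S" using assms(3) finite_subset by blast
  have "{Q \<in> Omega_n f n. Q \<inter> S = {}} = {Q. Q \<subseteq> {1..n} - S \<and> card Q = nat (f n)}"
    using assms unfolding Omega_n_def by auto
  then have "card {Q \<in> Omega_n f n. Q \<inter> S = {}} = (n - card S) choose nat (f n)"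
    using n_subsets[of "{1..n} - S" "nat (f n)"] assms(3) fS by (simp add: card_Diff_subset)
  moreover have "Omega_n f n = {Q. Q \<subseteq> {1..n} \<and> card Q = nat (f n)}"
    using assms unfolding Omega_n_def by auto
  then have "card (Omega_n f n) = n choose nat (f n)"
    using n_subsets[of "{1..n}" "nat (f n)"] by simp
  ultimately show ?thesis
    unfolding P_n_def by (subst measure_uniform_count_measure) (auto simp: finite_Omega_n)
qed

definition avoids :: "(nat \<Rightarrow> int) \<Rightarrow> nat set \<Rightarrow> (nat \<Rightarrow> nat set) \<Rightarrow> (nat \<Rightarrow> nat set) set" where
  "avoids f D T = {P \<in> space (P_f f). \<forall>n\<in>D. P n \<inter> T n = {}}"

text \<open>The event is a cylinder over the finite set \<open>D\<close>, so its probability is the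
  product of the one-coordinate probabilities.\<close>

lemma
  assumes f: "\<And>n. n \<ge> 1 \<Longrightarrow> 0 \<le> f n \<and> f n \<le> int n"
    and D: "finite D" "D \<subseteq> {1..}" and T: "\<And>n. n \<in> D \<Longrightarrow> T n \<subseteq> {1..n}"
  shows avoids_sets: "avoids f D T \<in> sets (P_f f)"
    and measure_avoids: "measure (P_f f) (avoids f D T)
      = (\<Prod>n\<in>D. real ((n - card (T n)) choose nat (f n)) / real (n choose nat (f n)))"
proof -
  let ?X = "\<lambda>n. {Q \<in> Omega_n f n. Q \<inter> T n = {}}"
  have X: "?X n \<in> sets (P_n f n)" for n
    unfolding P_n_def by (auto simp: sets_uniform_count_measure)
  have eq: "avoids f D T = prod_emb {1..} (P_n f) D (Pi\<^sub>E D ?X)"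
  proof -
    have sp: "space (P_n f n) = Omega_n f n" for n
      unfolding P_n_def by (simp add: space_uniform_count_measure)
    have "x \<in> avoids f D T \<longleftrightarrow> x \<in> prod_emb {1..} (P_n f) D (Pi\<^sub>E D ?X)" for x
    proof (cases "x \<in> Pi\<^sub>E {1..} (Omega_n f)")
      case True
      then have "x n \<in> Omega_n f n" if "n \<in> D" for n using that D(2) by (auto dest: PiE_mem)
      then show ?thesis
        using True by (auto simp: avoids_def prod_emb_def space_P_f sp restrict_PiE_iff Pi_iff)
    qed (simp add: avoids_def prod_emb_def space_P_f sp)
    then show ?thesis by blast
  qed
  show "avoids f D T \<in> sets (P_f f)"
    unfolding eq P_f_def using D X by (intro sets_PiM_I) auto
  have ps: "prob_space (P_n f n)" if "n \<in> {1..}" for n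
    unfolding P_n_def using f that
    by (intro prob_space_uniform_count_measure finite_Omega_n Omega_n_nonempty) auto
  have "emeasure (P_f f) (avoids f D T) = (\<Prod>n\<in>D. emeasure (P_n f n) (?X n))"
    unfolding eq P_f_def using D X ps by (intro emeasure_PiM_emb) auto
  also have "\<dots> = (\<Prod>n\<in>D. ennreal (measure (P_n f n) (?X n)))"
    using ps D(2) by (intro prod.cong refl finite_measure.emeasure_eq_measure prob_space.finite_measure) auto
  also have "\<dots> = ennreal (\<Prod>n\<in>D. measure (P_n f n) (?X n))"
    by (rule prod_ennreal) auto
  finally have "measure (P_f f) (avoids f D T) = (\<Prod>n\<in>D. measure (P_n f n) (?X n))"
    by (simp add: measure_def prod_nonneg)
  also have "\<dots> = (\<Prod>n\<in>D. real ((n - card (T n)) choose nat (f n)) / real (n choose nat (f n)))"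
    using D(2) f T by (intro prod.cong refl measure_P_n_disjoint) force+
  finally show "measure (P_f f) (avoids f D T)
      = (\<Prod>n\<in>D. real ((n - card (T n)) choose nat (f n)) / real (n choose nat (f n)))" .
qed

text \<open>A given element of \<open>{1..n}\<close> belongs to \<open>P n\<close> with probability
  \<open>f n / n\<close>. The exponent is thus minus the expected number of pairs
  \<open>(n, a)\<close> with \<open>n\<close> in \<open>D\<close> and \<open>a\<close> in both
  \<open>P n\<close> and \<open>T n\<close>.\<close>

lemma measure_avoids_le_exp:
  assumes f: "\<And>n. n \<ge> 1 \<Longrightarrow> 0 \<le> f n \<and> f n \<le> int n"
    and D: "finite D" "D \<subseteq> {1..}" and T: "\<And>n. n \<in> D \<Longrightarrow> T n \<subseteq> {1..n}"
  shows "measure (P_f f) (avoids f D T)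
    \<le> exp (- (\<Sum>n\<in>D. real_of_int (f n) / real n * real (card (T n))))"
proof -
  have "measure (P_f f) (avoids f D T)
      = (\<Prod>n\<in>D. real ((n - card (T n)) choose nat (f n)) / real (n choose nat (f n)))"
    by (rule measure_avoids[OF assms])
  also have "\<dots> \<le> (\<Prod>n\<in>D. exp (- (real_of_int (f n) / real n * real (card (T n)))))"
  proof (intro prod_mono conjI)
    fix n assume n: "n \<in> D"
    then have fn: "0 \<le> f n" "f n \<le> int n" using f D by auto
    have "card (T n) \<le> n" using card_mono[OF _ T[OF n]] by simp
    then show "real ((n - card (T n)) choose nat (f n)) / real (n choose nat (f n))
      \<le> exp (- (real_of_int (f n) / real n * real (card (T n))))"
      using choose_diff_ratio_le_exp[of "card (T n)" n "nat (f n)"] fn by simp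
  qed auto
  finally show ?thesis using D(1) by (simp add: exp_sum sum_negf[symmetric])
qed

text \<open>Both conditions together say that \<open>P n\<close> avoids
  \<open>T n \<union> T' n\<close>. Disjointness makes the cardinalities add, so the inequality for
  one coordinate applies to each factor.\<close>

lemma measure_avoids_negative_correlation:
  assumes f: "\<And>n. n \<ge> 1 \<Longrightarrow> 0 \<le> f n \<and> f n \<le> int n"
    and D: "finite D" "D \<subseteq> {1..}"
    and T: "\<And>n. n \<in> D \<Longrightarrow> T n \<subseteq> {1..n}" "\<And>n. n \<in> D \<Longrightarrow> T' n \<subseteq> {1..n}"
    and disj: "\<And>n. n \<in> D \<Longrightarrow> T n \<inter> T' n = {}"
  shows "measure (P_f f) (avoids f D T \<inter> avoids f D T')
    \<le> measure (P_f f) (avoids f D T) * measure (P_f f) (avoids f D T')"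
proof -
  have "avoids f D T \<inter> avoids f D T' = avoids f D (\<lambda>n. T n \<union> T' n)"
    unfolding avoids_def by auto
  then have "measure (P_f f) (avoids f D T \<inter> avoids f D T')
      = (\<Prod>n\<in>D. real ((n - card (T n \<union> T' n)) choose nat (f n)) / real (n choose nat (f n)))"
    using T by (simp only:, intro measure_avoids[OF f D]) auto
  also have "\<dots> \<le> (\<Prod>n\<in>D. real ((n - card (T n)) choose nat (f n)) / real (n choose nat (f n))
      * (real ((n - card (T' n)) choose nat (f n)) / real (n choose nat (f n))))"
  proof (intro prod_mono conjI)
    fix n assume n: "n \<in> D"
    have fin: "finite (T n)" "finite (T' n)" using T[OF n] finite_subset by blast+
    have c: "card (T n \<union> T' n) = card (T n) + card (T' n)"
      using fin disj[OF n] by (rule card_Un_disjoint)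
    have "card (T n \<union> T' n) \<le> card {1..n}" using T[OF n] by (intro card_mono) auto
    moreover have "nat (f n) \<le> n" using f n D(2) by force
    ultimately show "real ((n - card (T n \<union> T' n)) choose nat (f n)) / real (n choose nat (f n))
      \<le> real ((n - card (T n)) choose nat (f n)) / real (n choose nat (f n))
      * (real ((n - card (T' n)) choose nat (f n)) / real (n choose nat (f n)))"
      unfolding c by (intro choose_diff_negative_correlation) auto
  qed auto
  also have "\<dots> = measure (P_f f) (avoids f D T) * measure (P_f f) (avoids f D T')"
    using measure_avoids[OF f D T(1)] measure_avoids[OF f D T(2)] by (simp only: prod.distrib)
  finally show ?thesis .
qed

text \<open>Chebyshev's inequality: negative correlation leaves only the diagonal in the variance of
  the number of events \<open>A j\<close> that occur, so this variance is at most
  \<open>card J\<close>. Half of the mean proportion \<open>2 * \<kappa>\<close> is given up to the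
  deviation.\<close>

lemma (in prob_space) negatively_correlated_count:
  assumes J: "finite J" "J \<noteq> {}" and A: "\<And>j. j \<in> J \<Longrightarrow> A j \<in> events"
    and neg: "\<And>i j. i \<in> J \<Longrightarrow> j \<in> J \<Longrightarrow> i \<noteq> j \<Longrightarrow> prob (A i \<inter> A j) \<le> prob (A i) * prob (A j)"
    and mean: "2 * \<kappa> * real (card J) \<le> (\<Sum>j\<in>J. 1 - prob (A j))" and \<kappa>: "\<kappa> > 0"
  shows "{x \<in> space M. real (card {j \<in> J. x \<notin> A j}) < \<kappa> * real (card J)} \<in> events" (is "?B \<in> _")
    and "prob {x \<in> space M. real (card {j \<in> J. x \<notin> A j}) < \<kappa> * real (card J)}
      \<le> 1 / (\<kappa>\<^sup>2 * real (card J))"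
proof -
  define U where "U x = (\<Sum>j\<in>J. indicator (A j) x :: real)" for x
  have count: "real (card {j \<in> J. x \<notin> A j}) = real (card J) - U x" for x
  proof -
    have "U x = real (card {j \<in> J. x \<in> A j})"
      using J(1) unfolding U_def indicator_def by (simp add: sum.If_cases Collect_conj_eq)
    moreover have "card J = card {j \<in> J. x \<in> A j} + card {j \<in> J. x \<notin> A j}"
      using J(1) by (subst card_Un_disjoint[symmetric]) (auto intro: arg_cong[where f = card])
    ultimately show ?thesis by simp
  qed
  have [measurable]: "U \<in> borel_measurable M"
    unfolding U_def using A by (intro borel_measurable_sum borel_measurable_indicator) auto
  show "?B \<in> events" unfolding count by measurable
  have cJ: "real (card J) > 0" using J by (simp add: card_gt_0_iff)
  have int1: "integrable M (indicator (A j) :: _ \<Rightarrow> real)" if "j \<in> J" for j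
    using A[OF that] by (simp add: emeasure_eq_measure)
  have int2: "integrable M (indicator (A i \<inter> A j) :: _ \<Rightarrow> real)" if "i \<in> J" "j \<in> J" for i j
    using A[OF that(1)] A[OF that(2)] by (simp add: emeasure_eq_measure)
  have U2: "(U x)\<^sup>2 = (\<Sum>i\<in>J. \<Sum>j\<in>J. indicator (A i \<inter> A j) x)" for x
    unfolding U_def by (simp add: power2_eq_square sum_product indicator_inter_arith)
  have intU: "integrable M U" unfolding U_def using int1 by (intro Bochner_Integration.integrable_sum)
  have intU2: "integrable M (\<lambda>x. (U x)\<^sup>2)"
    unfolding U2 using int2 by (intro Bochner_Integration.integrable_sum)
  have space: "A j \<inter> space M = A j" if "j \<in> J" for j
    using A[OF that] sets.sets_into_space by blast
  have EU: "expectation U = (\<Sum>j\<in>J. prob (A j))"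
    unfolding U_def using int1 space by (subst Bochner_Integration.integral_sum) auto
  have "expectation (\<lambda>x. (U x)\<^sup>2) = (\<Sum>i\<in>J. expectation (\<lambda>x. \<Sum>j\<in>J. indicator (A i \<inter> A j) x))"
    unfolding U2 by (rule Bochner_Integration.integral_sum) (intro Bochner_Integration.integrable_sum int2)
  also have "\<dots> = (\<Sum>i\<in>J. \<Sum>j\<in>J. expectation (indicator (A i \<inter> A j)))"
    by (intro sum.cong refl Bochner_Integration.integral_sum int2)
  also have "\<dots> = (\<Sum>i\<in>J. \<Sum>j\<in>J. prob (A i \<inter> A j))"
    using space by (intro sum.cong refl) (simp add: Int_assoc)
  also have "\<dots> \<le> (\<Sum>i\<in>J. \<Sum>j\<in>J. prob (A i) * prob (A j) + (if i = j then 1 else 0))"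
  proof (intro sum_mono)
    fix i j assume ij: "i \<in> J" "j \<in> J"
    show "prob (A i \<inter> A j) \<le> prob (A i) * prob (A j) + (if i = j then 1 else 0)"
      using neg[OF ij] by (auto simp: add_increasing)
  qed
  also have "\<dots> = (expectation U)\<^sup>2 + real (card J)"
    using J(1) by (simp add: EU power2_eq_square sum_product sum.distrib)
  finally have var: "variance U \<le> real (card J)"
    using variance_eq[OF intU intU2] by simp
  have "prob ?B \<le> prob {x \<in> space M. \<bar>U x - expectation U\<bar> \<ge> \<kappa> * real (card J)}"
  proof (rule finite_measure_mono)
    \<comment> \<open>On \<open>?B\<close> the count \<open>U\<close> exceeds
      \<open>(1 - \<kappa>) * card J\<close>, while its mean is at most
      \<open>(1 - 2 * \<kappa>) * card J\<close>.\<close>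
    have "expectation U \<le> real (card J) - 2 * (\<kappa> * real (card J))"
      using mean by (simp add: EU sum_subtractf)
    then show "?B \<subseteq> {x \<in> space M. \<bar>U x - expectation U\<bar> \<ge> \<kappa> * real (card J)}"
      unfolding count by auto
  qed measurable
  also have "\<dots> \<le> variance U / (\<kappa> * real (card J))\<^sup>2"
    using intU2 \<kappa> cJ by (intro Chebyshev_inequality) auto
  also have "\<dots> \<le> real (card J) / (\<kappa> * real (card J))\<^sup>2"
    using var by (intro divide_right_mono) auto
  also have "\<dots> = 1 / (\<kappa>\<^sup>2 * real (card J))"
    using cJ \<kappa> by (simp add: power2_eq_square)
  finally show "prob ?B \<le> 1 / (\<kappa>\<^sup>2 * real (card J))" .
qed

section \<open>Occupied cells\<close>

text \<open>If \<open>m dvd m'\<close>, these are the cells of level \<open>m'\<close> that make up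
  cell \<open>i\<close> of level \<open>m\<close>. Otherwise the truncated quotient still keeps
  their number at most \<open>m' / m\<close> and, for \<open>i < m\<close>, their indices below
  \<open>m'\<close>; this covers levels before \<open>r\<close> without a case split.\<close>

definition subcells :: "nat \<Rightarrow> nat \<Rightarrow> nat \<Rightarrow> nat set" where
  "subcells m m' i = {i * (m' div m)..<Suc i * (m' div m)}"

definition fracs :: "nat \<Rightarrow> nat \<Rightarrow> nat \<Rightarrow> nat set" where
  "fracs n m j = {a \<in> {1..n}. real a / real n \<in> cell m j}"

definition hit :: "nat set \<Rightarrow> nat \<Rightarrow> (nat \<Rightarrow> nat set) \<Rightarrow> nat set" where
  "hit D m P = {j. \<exists>n\<in>D. \<exists>a\<in>P n. real a / real n \<in> cell m j}"

text \<open>The expected number of pairs \<open>(n, a)\<close> with \<open>n\<close> in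
  \<open>D\<close>, \<open>a\<close> in \<open>P n\<close> and \<open>a / n\<close> in the cell;
  equal fractions count with multiplicity.\<close>

definition intensity :: "(nat \<Rightarrow> int) \<Rightarrow> nat set \<Rightarrow> nat \<Rightarrow> nat \<Rightarrow> real" where
  "intensity f D m j = (\<Sum>n\<in>D. real_of_int (f n) / real n * real (card (fracs n m j)))"

lemma finite_subcells [simp]: "finite (subcells m m' i)"
  unfolding subcells_def by simp

lemma card_subcells: "card (subcells m m' i) = m' div m"
  unfolding subcells_def by simp

lemma real_card_subcells: "m dvd m' \<Longrightarrow> real (card (subcells m m' i)) = real m' / real m"
  by (simp add: card_subcells real_of_nat_div)

lemma card_subcells_le: "real (card (subcells m m' i)) \<le> real m' / real m"
  unfolding card_subcells by (rule of_nat_div_le_of_nat)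

lemma subcells_less:
  assumes "i < m" "j \<in> subcells m m' i"
  shows "j < m'"
proof -
  have "j < Suc i * (m' div m)" using assms(2) unfolding subcells_def by simp
  also have "\<dots> \<le> m * (m' div m)" using assms(1) by (intro mult_right_mono) auto
  also have "\<dots> \<le> m'" by simp
  finally show ?thesis .
qed

lemma subcells_iff:
  assumes m: "m > 0" "m' > 0" "m dvd m'" and x: "x \<in> cell m' j"
  shows "j \<in> subcells m m' i \<longleftrightarrow> x \<in> cell m i"
proof -
  obtain d where d: "m' = m * d" using m(3) by blast
  have dm: "m' div m = d" "d > 0" using d m by auto
  have sub: "x \<in> cell m i" if "j \<in> subcells m m' i" for i
  proof -
    have "i * d \<le> j" "Suc j \<le> Suc i * d" using that unfolding subcells_def dm by auto
    then have "real (i * d) \<le> real j" "real (Suc j) \<le> real (Suc i * d)" by (simp_all only: of_nat_le_iff)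
    moreover have "real j < x * real m * real d" "x * real m * real d \<le> real (Suc j)"
      using x mem_cell_iff[OF m(2)] d by (auto simp: ac_simps)
    ultimately have "real i * real d < x * real m * real d" "x * real m * real d \<le> real (Suc i) * real d"
      unfolding of_nat_mult by (metis order.strict_trans1, metis order.trans)
    then show ?thesis using dm(2) by (simp add: mem_cell_iff[OF m(1)] add.commute)
  qed
  have "j \<in> subcells m m' (j div d)"
    unfolding subcells_def dm using dm(2)
    by (auto simp: div_times_less_eq_dividend dividend_less_div_times)
  then show ?thesis using sub cell_unique[OF m(1)] by blast
qed

lemma dvd_seq_mono:
  fixes m :: "nat \<Rightarrow> nat"
  assumes "\<And>k. m k dvd m (Suc k)" "r \<le> k"
  shows "m r dvd m k"
  using assms(2)
proof (induction k rule: dec_induct)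
  case (step k)
  then show ?case using assms(1)[of k] dvd_trans by blast
qed simp

text \<open>Different cells have disjoint sets of numerators, so the events of being empty are
  negatively correlated. By Chebyshev the exceptional probability at level \<open>k\<close> is at
  most \<open>m r / (\<kappa>^2 * m k)\<close>, which is summable because \<open>m\<close> is
  lacunary. Borel-Cantelli handles one pair \<open>(r, i)\<close>, and there are countably many
  pairs.\<close>

lemma AE_hit:
  fixes m :: "nat \<Rightarrow> nat"
  assumes f: "\<And>n. n \<ge> 1 \<Longrightarrow> 0 \<le> f n \<and> f n \<le> int n"
    and m: "\<And>k. m k > 0" "\<And>k. 2 * m k \<le> m (Suc k)" "\<And>k. m k dvd m (Suc k)"
    and D: "\<And>k. finite (D k)" "\<And>k. D k \<subseteq> {1..}" and \<kappa>: "\<kappa> > 0"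
    and mean: "\<And>r i. i < m r \<Longrightarrow> \<forall>\<^sub>F k in sequentially. 2 * \<kappa> * (real (m k) / real (m r))
      \<le> (\<Sum>j\<in>subcells (m r) (m k) i. 1 - exp (- intensity f (D k) (m k) j))"
  shows "AE P in P_f f. \<forall>r. \<forall>i<m r. \<forall>\<^sub>F k in sequentially.
    \<kappa> * (real (m k) / real (m r)) \<le> real (card (subcells (m r) (m k) i \<inter> hit (D k) (m k) P))"
proof -
  interpret prob_space "P_f f" using f by (rule prob_space_P_f)
  have "AE P in P_f f. i < m r \<longrightarrow> (\<forall>\<^sub>F k in sequentially.
      \<kappa> * (real (m k) / real (m r)) \<le> real (card (subcells (m r) (m k) i \<inter> hit (D k) (m k) P)))" for r i
  proof (cases "i < m r")
    case True
    obtain k1 where k1: "\<And>k. k \<ge> k1 \<Longrightarrow> 2 * \<kappa> * (real (m k) / real (m r))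
      \<le> (\<Sum>j\<in>subcells (m r) (m k) i. 1 - exp (- intensity f (D k) (m k) j))"
      using mean[OF True] by (auto simp: eventually_sequentially)
    \<comment> \<open>From \<open>r\<close> on the cell numbers divide, and from \<open>k1\<close>
      on the mean bound holds. Before \<open>k0\<close> the bad event \<open>B k\<close> is set to
      be empty, so that its probability bound holds for every \<open>k\<close>.\<close>
    define k0 where "k0 = max r k1"
    define J where "J k = subcells (m r) (m k) i" for k
    define A where "A k j = avoids f (D k) (\<lambda>n. fracs n (m k) j)" for k j
    define B where "B k = (if k \<ge> k0 then
      {P \<in> space (P_f f). real (card {j \<in> J k. P \<notin> A k j}) < \<kappa> * real (card (J k))} else {})" for k
    have sub: "fracs n (m k) j \<subseteq> {1..n}" for n k j unfolding fracs_def by auto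
    have A: "A k j \<in> events" for k j
      unfolding A_def using f D sub by (intro avoids_sets) auto
    have cJ: "real (card (J k)) = real (m k) / real (m r)" if "k \<ge> k0" for k
      unfolding J_def using dvd_seq_mono[of m r k, OF m(3)] that by (intro real_card_subcells) (auto simp: k0_def)
    have B: "B k \<in> events \<and> prob (B k) \<le> 1 / \<kappa>\<^sup>2 * (1/2)^(k - r)" for k
    proof (cases "k \<ge> k0")
      case True
      have J: "finite (J k)" "J k \<noteq> {}"
        using cJ[OF True] m(1)[of k] m(1)[of r] unfolding J_def by auto
      have neg: "prob (A k i \<inter> A k j) \<le> prob (A k i) * prob (A k j)" if "i \<noteq> j" for i j
        unfolding A_def using f D sub
      proof (intro measure_avoids_negative_correlation)
        show "fracs n (m k) i \<inter> fracs n (m k) j = {}" for n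
          using that cell_unique[OF m(1)] unfolding fracs_def by blast
      qed auto
      have mean': "2 * \<kappa> * real (card (J k)) \<le> (\<Sum>j\<in>J k. 1 - prob (A k j))"
      proof -
        have "2 * \<kappa> * real (card (J k)) \<le> (\<Sum>j\<in>J k. 1 - exp (- intensity f (D k) (m k) j))"
          using k1[of k] True cJ[OF True] unfolding J_def k0_def by auto
        also have "\<dots> \<le> (\<Sum>j\<in>J k. 1 - prob (A k j))"
          unfolding A_def intensity_def using f D sub
          by (intro sum_mono diff_left_mono measure_avoids_le_exp) auto
        finally show ?thesis .
      qed
      note count = negatively_correlated_count[OF J A neg mean' \<kappa>, simplified]
      have "1 / (\<kappa>\<^sup>2 * real (card (J k))) = 1 / \<kappa>\<^sup>2 * (real (m r) / real (m k))"
        using cJ[OF True] by simp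
      also have "\<dots> \<le> 1 / \<kappa>\<^sup>2 * (1/2)^(k - r)"
        using lacunary_ratio[of m r k, OF m(1,2)] True by (intro mult_left_mono) (auto simp: k0_def)
      finally show ?thesis using count True unfolding B_def by auto
    qed (simp add: B_def)
    have "summable (\<lambda>k. 1 / \<kappa>\<^sup>2 * (1/2)^(k - r))"
      by (subst summable_iff_shift[of _ r, symmetric]) (simp add: summable_geometric)
    then have "summable (\<lambda>k. prob (B k))"
    proof (rule summable_comparison_test'[where N = 0])
      show "norm (prob (B k)) \<le> 1 / \<kappa>\<^sup>2 * (1/2)^(k - r)" for k
        using B[of k] by (simp only: real_norm_def abs_of_nonneg measure_nonneg)
    qed
    then have "AE P in P_f f. \<forall>\<^sub>F k in sequentially. P \<in> space (P_f f) - B k"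
      using B by (intro borel_cantelli_AE1) (auto simp: emeasure_eq_measure)
    then show ?thesis
    proof (rule AE_mp, intro AE_I2 impI)
      fix P assume P: "P \<in> space (P_f f)" and "\<forall>\<^sub>F k in sequentially. P \<in> space (P_f f) - B k"
      from this(2) eventually_ge_at_top[of k0]
      show "\<forall>\<^sub>F k in sequentially. \<kappa> * (real (m k) / real (m r))
        \<le> real (card (subcells (m r) (m k) i \<inter> hit (D k) (m k) P))"
      proof eventually_elim
        case (elim k)
        have PO: "P n \<subseteq> {1..n}" if "n \<in> D k" for n
          using P that D(2)[of k] unfolding space_P_f Omega_n_def by (auto dest!: PiE_mem[of _ _ _ n])
        \<comment> \<open>Points of the space satisfy \<open>P n \<subseteq> {1..n}\<close>, so a
          cell that is not avoided is the same as a cell that is hit.\<close>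
        have "{j \<in> J k. P \<notin> A k j} = J k \<inter> hit (D k) (m k) P"
          using P PO unfolding A_def avoids_def hit_def fracs_def by blast
        then show ?case using elim P cJ[of k] unfolding B_def J_def by auto
      qed
    qed
  qed simp
  then show ?thesis by (simp add: AE_all_countable)
qed

section \<open>The limsup set for a fixed choice of numerators\<close>

lemma emeasure_W_eq_0:
  assumes P: "\<And>n. n \<ge> 1 \<Longrightarrow> finite (P n) \<and> int (card (P n)) = f n"
    and \<Psi>: "\<And>n. n \<ge> 1 \<Longrightarrow> 0 \<le> \<Psi> n"
    and conv: "(\<Sum>n. ennreal (real_of_int (f (Suc n)) * \<Psi> (Suc n))) < \<infinity>"
  shows "emeasure lebesgue (W P \<Psi>) = 0"
proof -
  define I where "I n a = {real a / real n - \<Psi> n<..<real a / real n + \<Psi> n}" for n a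
  \<comment> \<open>One set per denominator, with index \<open>n\<close> standing for the
    denominator \<open>n + 1\<close>.\<close>
  define A where "A n = (\<Union>a\<in>P (Suc n). I (Suc n) a)" for n
  have Al: "A n \<in> lmeasurable" for n
    unfolding A_def I_def using P by (intro fmeasurable.finite_UN) auto
  have f0: "0 \<le> f (Suc n)" for n using P[of "Suc n"] by (metis le_add1 of_nat_0_le_iff plus_1_eq_Suc)
  have "measure lebesgue (A n) \<le> 2 * (real_of_int (f (Suc n)) * \<Psi> (Suc n))" for n
  proof -
    have "measure lebesgue (A n) \<le> (\<Sum>a\<in>P (Suc n). measure lebesgue (I (Suc n) a))"
      unfolding A_def I_def using P by (intro measure_UNION_le) auto
    also have "\<dots> = real (card (P (Suc n))) * (2 * \<Psi> (Suc n))"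
      unfolding I_def using \<Psi>[of "Suc n"] by simp
    also have "real (card (P (Suc n))) = real_of_int (f (Suc n))"
      using P[of "Suc n"] by (metis le_add1 of_int_of_nat_eq plus_1_eq_Suc)
    finally show ?thesis by simp
  qed
  moreover have "summable (\<lambda>n. 2 * (real_of_int (f (Suc n)) * \<Psi> (Suc n)))"
    using conv f0 \<Psi> by (intro summable_mult summable_suminf_not_top) (auto simp: less_top)
  ultimately have "summable (\<lambda>n. measure lebesgue (A n))"
    using summable_comparison_test'[of _ 0 "\<lambda>n. measure lebesgue (A n)"]
    by (simp only: real_norm_def abs_of_nonneg measure_nonneg)
  then have "limsup A \<in> null_sets lebesgue"
  proof (rule borel_cantelli_limsup1[rotated 2])
    show "A n \<in> sets lebesgue" for n using Al by blast
    show "emeasure lebesgue (A n) < \<infinity>" for n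
      using fmeasurableD2[OF Al[of n]] by (simp only: infinity_ennreal_def less_top)
  qed
  moreover have "W P \<Psi> \<subseteq> limsup A"
  proof
    fix x assume "x \<in> W P \<Psi>"
    then have inf: "infinite {(n, a). n \<ge> 1 \<and> a \<in> P n \<and> \<bar>x - real a / real n\<bar> < \<Psi> n}"
      unfolding W_def by auto
    \<comment> \<open>Each \<open>P n\<close> is finite, so infinitely many pairs involve infinitely
      many denominators.\<close>
    have "\<exists>n\<ge>N. x \<in> A n" for N
    proof (rule ccontr)
      assume *: "\<not> ?thesis"
      have "{(n, a). n \<ge> 1 \<and> a \<in> P n \<and> \<bar>x - real a / real n\<bar> < \<Psi> n} \<subseteq> (SIGMA n:{1..N}. P n)"
      proof (rule subrelI)
        fix n a assume "(n, a) \<in> {(n, a). n \<ge> 1 \<and> a \<in> P n \<and> \<bar>x - real a / real n\<bar> < \<Psi> n}"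
        then have na: "1 \<le> n" "a \<in> P n" "\<bar>x - real a / real n\<bar> < \<Psi> n" by auto
        obtain n' where n': "n = Suc n'" using na(1) by (cases n) auto
        have "x \<in> I n a" using na(3) unfolding I_def by auto
        then have "x \<in> A n'" unfolding A_def using na(2) n' by blast
        then have "n \<le> N" using * n' by (metis not_less_eq_eq)
        then show "(n, a) \<in> (SIGMA n:{1..N}. P n)" using na by auto
      qed
      moreover have "finite (SIGMA n:{1..N}. P n)" using P by (intro finite_SigmaI) auto
      ultimately show False using inf finite_subset by blast
    qed
    then show "x \<in> limsup A" by (auto simp: limsup_INF_SUP)
  qed
  moreover have "W P \<Psi> \<in> sets lebesgue" using W_borel by simp
  ultimately have "W P \<Psi> \<in> null_sets lebesgue" using null_sets_subset by blast
  then show ?thesis by (rule null_setsD1)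
qed

section \<open>The divergence case\<close>

text \<open>The exponent starts at \<open>k + 1\<close> so that, with \<open>m k = M^k\<close> and
  \<open>M >= 2\<close>, all denominators of block \<open>k\<close> exceed
  \<open>2 * m k\<close>.\<close>

definition block :: "nat \<Rightarrow> nat \<Rightarrow> nat set" where
  "block M k = {M ^ (k + 1)<..M ^ (k + 2)}"

text \<open>A condensation argument: the blocks \<open>Suc k\<close> with \<open>k >= K\<close>
  cover all \<open>n\<close> beyond \<open>M^(K + 2)\<close>, and \<open>G\<close> is the finite sum
  before them.\<close>

lemma sum_blocks_bounded:
  fixes g :: "nat \<Rightarrow> real"
  assumes M: "M \<ge> 2" and g: "\<And>n. n \<ge> 1 \<Longrightarrow> 0 \<le> g n" and a: "\<And>k. 0 \<le> a k" "summable a"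
    and le: "\<And>k. k \<ge> K \<Longrightarrow> (\<Sum>n\<in>block M (Suc k). g n) \<le> a k"
  shows "summable (\<lambda>n. g (Suc n))"
proof -
  define G where "G = (\<Sum>n=1..M ^ (K + 2). g n)"
  have mono: "{1..M ^ (k + 2)} \<union> block M (Suc k) = {1..M ^ (Suc k + 2)}" for k
  proof -
    have *: "{1..b} \<union> {b<..c} = {1..c}" if "1 \<le> b" "b \<le> c" for b c :: nat using that by auto
    have "M ^ (k + 2) \<le> M ^ (Suc k + 2)" using M by (intro power_increasing) auto
    moreover have "1 \<le> M ^ (k + 2)" using M by (intro one_le_power) auto
    moreover have "Suc k + 1 = k + 2" by simp
    ultimately show ?thesis unfolding block_def using * by metis
  qed
  have "(\<Sum>n=1..M ^ (K + d + 2). g n) \<le> G + (\<Sum>k<K + d. a k)" for d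
  proof (induction d)
    case 0
    then show ?case unfolding G_def using a by (simp add: sum_nonneg)
  next
    case (Suc d)
    have "(\<Sum>n=1..M ^ (Suc (K + d) + 2). g n) = (\<Sum>n\<in>{1..M ^ (K + d + 2)} \<union> block M (Suc (K + d)). g n)"
      using mono[of "K + d"] by simp
    also have "\<dots> = (\<Sum>n=1..M ^ (K + d + 2). g n) + (\<Sum>n\<in>block M (Suc (K + d)). g n)"
      by (rule sum.union_disjoint) (auto simp: block_def)
    also have "\<dots> \<le> G + (\<Sum>k<K + d. a k) + a (K + d)" using Suc le[of "K + d"] by auto
    finally show ?case by simp
  qed note blocks = this
  show ?thesis
  proof (rule bounded_imp_summable)
    fix N
    have "N + 1 \<le> M ^ (K + N + 2)"
    proof -
      have "K + N + 2 < 2 ^ (K + N + 2)" by (rule less_exp)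
      also have "\<dots> \<le> M ^ (K + N + 2)" using M by (intro power_mono) auto
      finally show ?thesis by simp
    qed
    have "(\<Sum>n\<le>N. g (Suc n)) = (\<Sum>n=1..N + 1. g n)"
      by (rule sum.reindex_bij_witness[of _ "\<lambda>n. n - 1" Suc]) auto
    also have "\<dots> \<le> (\<Sum>n=1..M ^ (K + N + 2). g n)"
      using g \<open>N + 1 \<le> _\<close> by (intro sum_mono2) auto
    also have "\<dots> \<le> G + (\<Sum>k<K + N. a k)" by (rule blocks)
    also have "\<dots> \<le> G + (\<Sum>k. a k)" using a by (intro add_left_mono sum_le_suminf) auto
    finally show "(\<Sum>n\<le>N. g (Suc n)) \<le> G + (\<Sum>k. a k)" .
  qed (use g in auto)
qed

text \<open>The terms of the truncated series tend to 0, so the truncation at \<open>c > 0\<close>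
  is eventually inactive.\<close>

lemma summable_min_imp_summable:
  fixes a :: "nat \<Rightarrow> real"
  assumes "\<And>k. 0 \<le> a k" "summable (\<lambda>k. min (a k) c)" "c > 0"
  shows "summable a"
proof -
  have "(\<lambda>k. min (a k) c) \<longlonglongrightarrow> 0" using assms(2) by (rule summable_LIMSEQ_zero)
  then have "\<forall>\<^sub>F k in sequentially. min (a k) c < c"
    using assms(3) by (rule order_tendstoD)
  then have "\<forall>\<^sub>F k in sequentially. min (a k) c = a k"
    by (rule eventually_mono) (auto simp: min_def split: if_splits)
  then show ?thesis using assms(2) summable_cong by metis
qed

text \<open>Here \<open>P\<close> is fixed. The value of \<open>\<Psi>\<close> at
  \<open>M^(k + 2)\<close>, the end of block \<open>k\<close>, bounds \<open>\<Psi>\<close> from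
  below on block \<open>k\<close> and from above on block \<open>Suc k\<close>. Hence the fractions
  come from block \<open>k\<close>, while the growth bound with \<open>C\<close> concerns block
  \<open>Suc k\<close> and carries the divergence over to the series of \<open>a k\<close>.\<close>

lemma emeasure_W_eq_1:
  fixes m :: "nat \<Rightarrow> nat"
  assumes M: "M \<ge> 2" and m: "\<And>k. m k > 0" "\<And>k. 2 * m k \<le> m (Suc k)" "\<And>k. m k dvd m (Suc k)"
    and f: "\<And>n. n \<ge> 1 \<Longrightarrow> 0 \<le> f n"
    and C: "\<forall>\<^sub>F k in sequentially. (\<Sum>n\<in>block M (Suc k). real_of_int (f n)) \<le> C * real (m k)"
    and \<kappa>: "\<kappa> > 0"
    and ubiq: "\<And>r i. i < m r \<Longrightarrow> \<forall>\<^sub>F k in sequentially. \<kappa> * (real (m k) / real (m r))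
      \<le> real (card (subcells (m r) (m k) i \<inter> hit (block M k) (m k) P))"
    and \<Psi>: "\<And>n. n \<ge> 1 \<Longrightarrow> 0 \<le> \<Psi> n" "antimono_on {1..} \<Psi>"
    and div: "(\<Sum>n. ennreal (real_of_int (f (Suc n)) * \<Psi> (Suc n))) = \<infinity>"
  shows "emeasure lebesgue (W P \<Psi>) = 1"
proof -
  have anti: "\<Psi> n' \<le> \<Psi> n" if "1 \<le> n" "n \<le> n'" for n n'
    using \<Psi>(2) that by (auto simp: monotone_on_def)
  have M1: "1 \<le> M ^ e" for e using M by (intro one_le_power) auto
  define a where "a k = \<Psi> (M ^ (k + 2)) * real (m k)" for k
  have a0: "0 \<le> a k" for k unfolding a_def by (intro mult_nonneg_nonneg \<Psi>(1)[OF M1]) simp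
  have "\<not> summable a"
  proof
    assume "summable a"
    obtain K where K: "\<And>k. k \<ge> K \<Longrightarrow> (\<Sum>n\<in>block M (Suc k). real_of_int (f n)) \<le> C * real (m k)"
      using C by (auto simp: eventually_sequentially)
    have "summable (\<lambda>n. real_of_int (f (Suc n)) * \<Psi> (Suc n))"
    proof (rule sum_blocks_bounded[where a = "\<lambda>k. \<bar>C\<bar> * a k" and K = K, OF M])
      show "0 \<le> real_of_int (f n) * \<Psi> n" if "n \<ge> 1" for n using f \<Psi>(1) that by simp
      show "0 \<le> \<bar>C\<bar> * a k" for k using a0 by simp
      show "summable (\<lambda>k. \<bar>C\<bar> * a k)" using \<open>summable a\<close> by (rule summable_mult)
      fix k assume k: "k \<ge> K"
      have "(\<Sum>n\<in>block M (Suc k). real_of_int (f n) * \<Psi> n)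
          \<le> (\<Sum>n\<in>block M (Suc k). real_of_int (f n) * \<Psi> (M ^ (k + 2)))"
      proof (intro sum_mono mult_left_mono anti M1)
        fix n assume "n \<in> block M (Suc k)"
        then have "M ^ (k + 2) < n" unfolding block_def by simp
        then show "M ^ (k + 2) \<le> n" "0 \<le> real_of_int (f n)" using f[of n] by auto
      qed
      also have "\<dots> = (\<Sum>n\<in>block M (Suc k). real_of_int (f n)) * \<Psi> (M ^ (k + 2))"
        by (rule sum_distrib_right[symmetric])
      also have "\<dots> \<le> (\<bar>C\<bar> * real (m k)) * \<Psi> (M ^ (k + 2))"
      proof (rule mult_right_mono)
        have "C * real (m k) \<le> \<bar>C\<bar> * real (m k)" by (intro mult_right_mono) auto
        then show "(\<Sum>n\<in>block M (Suc k). real_of_int (f n)) \<le> \<bar>C\<bar> * real (m k)"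
          using K[OF k] by linarith
      qed (rule \<Psi>(1)[OF M1])
      finally show "(\<Sum>n\<in>block M (Suc k). real_of_int (f n) * \<Psi> n) \<le> \<bar>C\<bar> * a k"
        unfolding a_def by (simp add: ac_simps)
    qed
    then have "(\<Sum>n. ennreal (real_of_int (f (Suc n)) * \<Psi> (Suc n))) \<noteq> top"
      using f \<Psi>(1) by (intro ennreal_suminf_neq_top) auto
    then show False using div by simp
  qed
  \<comment> \<open>Truncated to half a cell, which preserves divergence and leaves room on at least
    one side of any point of the cell.\<close>
  define h where "h k = min (a k) (1/2) / real (m k)" for k
  have h: "0 \<le> h k" "h k * real (m k) = min (a k) (1/2)" "h k \<le> \<Psi> (M ^ (k + 2))" for k
  proof -
    show "0 \<le> h k" unfolding h_def using a0[of k] by simp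
    show "h k * real (m k) = min (a k) (1/2)" unfolding h_def using m(1)[of k] by simp
    have "min (a k) (1/2) \<le> a k" by simp
    then show "h k \<le> \<Psi> (M ^ (k + 2))" unfolding h_def a_def using m(1)[of k] by (simp add: pos_divide_le_eq)
  qed
  have hm: "\<not> summable (\<lambda>k. h k * real (m k))"
    unfolding h(2) using summable_min_imp_summable[of a "1/2"] a0 \<open>\<not> summable a\<close> by auto
  have h_half: "2 * h k \<le> 1 / real (m k)" for k
    using h(2)[of k] m(1)[of k] by (simp add: field_simps)
  \<comment> \<open>A single fraction is chosen in each occupied cell, so multiplicities and
    overlaps within a level do not arise.\<close>
  define z where "z k j = (SOME z. fst z \<in> block M k \<and> snd z \<in> P (fst z)
    \<and> real (snd z) / real (fst z) \<in> cell (m k) j)" for k j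
  define n where "n k j = fst (z k j)" for k j
  define p where "p k j = snd (z k j)" for k j
  have np: "n k j \<in> block M k \<and> p k j \<in> P (n k j) \<and> real (p k j) / real (n k j) \<in> cell (m k) j"
    if "j \<in> hit (block M k) (m k) P" for k j
  proof -
    have "\<exists>z. fst z \<in> block M k \<and> snd z \<in> P (fst z) \<and> real (snd z) / real (fst z) \<in> cell (m k) j"
      using that unfolding hit_def by force
    then show ?thesis unfolding n_def p_def z_def by (rule someI_ex)
  qed
  define q where "q k j = real (p k j) / real (n k j)" for k j
  \<comment> \<open>The interval has the fraction as its left end if it then fits in the cell, and
    as its right end otherwise.\<close>
  define u where "u k j = (if q k j + h k \<le> real (Suc j) / real (m k) then q k j else q k j - h k)" for k j
  have u: "real j / real (m k) \<le> u k j \<and> u k j + h k \<le> real (Suc j) / real (m k)"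
    if "j \<in> hit (block M k) (m k) P" for k j
  proof -
    have "real j / real (m k) < q k j" "q k j \<le> real (Suc j) / real (m k)"
      using np[OF that] unfolding q_def cell_def by (auto simp del: of_nat_Suc)
    moreover have "real (Suc j) / real (m k) = real j / real (m k) + 1 / real (m k)"
      by (simp add: add_divide_distrib)
    ultimately show ?thesis unfolding u_def using h_half[of k] by (auto simp del: of_nat_Suc)
  qed
  have near: "\<bar>x - q k j\<bar> < \<Psi> (n k j)" if "j \<in> hit (block M k) (m k) P" "x \<in> {u k j<..<u k j + h k}" for k j x
  proof -
    have "\<bar>x - q k j\<bar> < h k" using that(2) unfolding u_def by (auto split: if_splits)
    also have "\<dots> \<le> \<Psi> (M ^ (k + 2))" by (rule h)
    also have "\<dots> \<le> \<Psi> (n k j)"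
      using np[OF that(1)] by (intro anti) (auto simp: block_def)
    finally show ?thesis .
  qed
  show ?thesis
  proof (rule emeasure_eq_1_of_cells[where m = m and c = "\<kappa>\<^sup>2 / 2"])
    show "W P \<Psi> \<in> sets borel" by (rule W_borel)
    show "W P \<Psi> \<subseteq> {0..1}" unfolding W_def by auto
    show "0 < \<kappa>\<^sup>2 / 2" using \<kappa> by simp
    show "0 < m r" for r by (rule m)
    have "k \<le> m k" for k
    proof (induction k)
      case (Suc k)
      then show ?case using m(1)[of k] m(2)[of k] by linarith
    qed simp
    then show "filterlim m at_top sequentially"
      by (intro filterlim_at_top_mono[OF filterlim_ident]) auto
    fix r i assume i: "i < m r"
    define X where "X k = subcells (m r) (m k) i \<inter> hit (block M k) (m k) P" for k
    define L where "L = (\<Inter>n. \<Union>k\<in>{n..}. \<Union>j\<in>X k. {u k j<..<u k j + h k})"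
    have LW: "L \<subseteq> W P \<Psi> \<inter> cell (m r) i"
    proof
      fix x assume x: "x \<in> L"
      have ex: "\<exists>k\<ge>N. \<exists>j\<in>X k. x \<in> {u k j<..<u k j + h k}" for N
        using x unfolding L_def by (auto simp: Bex_def)
      obtain k j where kj: "k \<ge> r" "j \<in> X k" "x \<in> {u k j<..<u k j + h k}" using ex by blast
      have "x \<in> cell (m k) j"
        using open_interval_subset_cell[of j "m k" "u k j" "h k"] u[of j k] kj unfolding X_def by blast
      then have xc: "x \<in> cell (m r) i"
        using subcells_iff[of "m r" "m k" x j i] m(1) dvd_seq_mono[of m r k, OF m(3)] kj unfolding X_def by auto
      then have "x \<in> {0..1}" using cell_subset_unit[OF i] by auto
      moreover have "infinite {(n, a). n \<ge> 1 \<and> a \<in> P n \<and> \<bar>x - real a / real n\<bar> < \<Psi> n}" (is "infinite ?S")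
      proof
        assume "finite ?S"
        then have "finite (fst ` ?S)" by (rule finite_imageI)
        then obtain N where B: "\<forall>n\<in>fst ` ?S. n \<le> N" unfolding finite_nat_set_iff_bounded_le ..
        have N: "n' \<le> N" if "(n', a) \<in> ?S" for n' a
          using bspec[OF B imageI[OF that, of fst]] by (simp only: fst_conv)
        obtain k j where kj: "k \<ge> N" "j \<in> X k" "x \<in> {u k j<..<u k j + h k}" using ex by blast
        then have hit: "j \<in> hit (block M k) (m k) P" unfolding X_def by blast
        \<comment> \<open>Denominators in block \<open>k\<close> exceed \<open>k + 1\<close>, so
          membership at arbitrarily high levels gives infinitely many pairs.\<close>
        have "k + 1 < 2 ^ (k + 1)" by (rule less_exp)
        also have "\<dots> \<le> M ^ (k + 1)" using M by (intro power_mono) auto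
        also have "\<dots> < n k j" using np[OF hit] unfolding block_def by auto
        finally have big: "k + 1 < n k j" .
        then have "1 \<le> n k j" by linarith
        then have "(n k j, p k j) \<in> ?S"
          using near[OF hit kj(3)] np[OF hit] unfolding q_def mem_Collect_eq prod.case by (intro conjI) blast+
        then have "n k j \<le> N" by (rule N)
        then show False using big kj(1) by linarith
      qed
      ultimately show "x \<in> W P \<Psi> \<inter> cell (m r) i" using xc unfolding W_def by auto
    qed
    \<comment> \<open>The limsup bound is used with \<open>b = 1 / m r\<close>, the share of all
      cells that lie in cell \<open>i\<close> of level \<open>r\<close>. This is also the measure of
      that cell, which leaves the proportion \<open>\<kappa>^2 / 2\<close>.\<close>
    have "\<kappa>\<^sup>2 * (1 / real (m r)) / 2 \<le> measure lebesgue L"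
      unfolding L_def
    proof (rule measure_limsup_pieces[where m = m])
      show "h k * real (m k) \<le> 1" for k unfolding h(2) by simp
      show "X k \<subseteq> {..<m k}" for k unfolding X_def using subcells_less[OF i] by auto
      show "real (card (X k)) \<le> 1 / real (m r) * real (m k)" for k
      proof -
        have "card (X k) \<le> card (subcells (m r) (m k) i)" unfolding X_def by (intro card_mono) auto
        then show ?thesis using card_subcells_le[of "m r" "m k" i] by simp
      qed
      show "\<forall>\<^sub>F k in sequentially. \<kappa> * (1 / real (m r)) * real (m k) \<le> real (card (X k))"
        using ubiq[OF i] unfolding X_def by simp
      show "real j / real (m k) \<le> u k j \<and> u k j + h k \<le> real (Suc j) / real (m k)" if "j \<in> X k" for k j
        using that unfolding X_def by (intro u) blast
      show "0 < 1 / real (m r)" using m(1)[of r] by simp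
    qed (rule m h(1) hm \<kappa>)+
    also have "\<dots> \<le> measure lebesgue (W P \<Psi> \<inter> cell (m r) i)"
    proof (rule measure_mono_fmeasurable[OF LW])
      have "open (\<Union>k\<in>{n..}. \<Union>j\<in>X k. {u k j<..<u k j + h k})" for n
        by (intro open_UN ballI open_greaterThanLessThan)
      then show "L \<in> sets lebesgue"
        unfolding L_def by (intro sets.countable_INT image_subsetI) simp_all
      have "W P \<Psi> \<inter> cell (m r) i \<in> sets lebesgue"
        using W_borel[of P \<Psi>] by (intro sets.Int) simp_all
      then show "W P \<Psi> \<inter> cell (m r) i \<in> lmeasurable"
        by (intro fmeasurableI2[OF cell_lmeasurable[of "m r" i]] Int_lower2)
    qed
    finally show "\<kappa>\<^sup>2 / 2 / real (m r) \<le> measure lebesgue (W P \<Psi> \<inter> cell (m r) i)" by simp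
  qed
qed

section \<open>Counting fractions in cells\<close>

text \<open>Since \<open>j < m\<close>, the upper end is at most \<open>n\<close>, so the
  restriction \<open>a <= n\<close> is automatic and the numerators fill a half-open
  interval.\<close>

lemma fracs_eq:
  assumes "m > 0" "n > 0" "j < m"
  shows "fracs n m j = {n * j div m<..n * Suc j div m}"
proof -
  have iff: "real a / real n \<in> cell m j \<longleftrightarrow> n * j div m < a \<and> a \<le> n * Suc j div m" for a
  proof -
    have "real a / real n \<in> cell m j \<longleftrightarrow> real (n * j) < real (a * m) \<and> real (a * m) \<le> real (n * Suc j)"
      using assms by (simp add: mem_cell_iff field_simps)
    also have "\<dots> \<longleftrightarrow> n * j < a * m \<and> a * m \<le> n * Suc j" by (simp only: of_nat_less_iff of_nat_le_iff)
    also have "\<dots> \<longleftrightarrow> n * j div m < a \<and> a \<le> n * Suc j div m"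
      using assms(1) by (simp only: div_less_iff_less_mult less_eq_div_iff_mult_less_eq)
    finally show ?thesis .
  qed
  have "n * Suc j div m \<le> n * m div m" using assms by (intro div_le_mono mult_left_mono) auto
  then have "n * Suc j div m \<le> n" using assms by simp
  moreover define lo hi where "lo = n * j div m" and "hi = n * Suc j div m"
  ultimately show ?thesis unfolding fracs_def iff lo_def[symmetric] hi_def[symmetric] by auto
qed

lemma finite_fracs [simp]: "finite (fracs n m j)"
  unfolding fracs_def by simp

lemma
  assumes "m > 0" "n > 0" "j < m"
  shows card_fracs_ge: "real n / real m - 1 \<le> real (card (fracs n m j))"
    and card_fracs_le: "real (card (fracs n m j)) \<le> real n / real m + 1"
proof -
  have ge: "real x / real m - 1 \<le> real (x div m)" for x
    using floor_divide_of_nat_eq[of x m, where 'a = real] by linarith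
  have le: "real (x div m) \<le> real x / real m" for x
    by (rule of_nat_div_le_of_nat)
  have "n * j div m \<le> n * Suc j div m" by (intro div_le_mono mult_left_mono) auto
  then have c: "real (card (fracs n m j)) = real (n * Suc j div m) - real (n * j div m)"
    using fracs_eq[OF assms] by (simp add: of_nat_diff)
  have d: "real (n * Suc j) / real m = real (n * j) / real m + real n / real m"
    by (simp add: add_divide_distrib algebra_simps)
  show "real n / real m - 1 \<le> real (card (fracs n m j))"
    using ge[of "n * Suc j"] le[of "n * j"] unfolding c d by linarith
  show "real (card (fracs n m j)) \<le> real n / real m + 1"
    using ge[of "n * j"] le[of "n * Suc j"] unfolding c d by linarith
qed

lemma fracs_subcells:
  assumes "m > 0" "m' > 0" "m dvd m'"
  shows "fracs n m i = (\<Union>j\<in>subcells m m' i. fracs n m' j)"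
proof (intro equalityI subsetI)
  fix a assume a: "a \<in> fracs n m i"
  then have "real a / real n \<in> {0<..1}" unfolding fracs_def by auto
  then obtain j where "j < m'" "real a / real n \<in> cell m' j" using cell_cover[OF assms(2)] by blast
  then show "a \<in> (\<Union>j\<in>subcells m m' i. fracs n m' j)"
    using a subcells_iff[OF assms] unfolding fracs_def by blast
next
  fix a assume "a \<in> (\<Union>j\<in>subcells m m' i. fracs n m' j)"
  then show "a \<in> fracs n m i"
    using subcells_iff[OF assms] unfolding fracs_def by blast
qed

lemma fracs_disjoint:
  assumes "m > 0" "i \<noteq> j"
  shows "fracs n m i \<inter> fracs n m j = {}"
  using assms cell_unique unfolding fracs_def by blast

text \<open>The numerators \<open>a\<close> for which \<open>a / n\<close> has reduced denominator greater than \<open>Q\<close>.\<close>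

definition high_denom :: "nat \<Rightarrow> nat \<Rightarrow> nat set" where
  "high_denom Q n = {a. \<not> (\<exists>q\<le>Q. q dvd n \<and> n dvd a * q)}"

text \<open>If \<open>a / n\<close> has a denominator \<open>q <= Q\<close> with
  \<open>q dvd n\<close>, then \<open>n = q * g\<close> and \<open>a = g * p\<close> with
  \<open>g <= N div q\<close> and \<open>p / q\<close> in the cell. There are at most
  \<open>q / m + 1\<close> such \<open>p\<close>. Fractions counted for several \<open>q\<close> do
  no harm to an upper bound.\<close>

lemma card_low_denom_le:
  assumes m: "m > 0" "i < m" and D: "finite D" "D \<subseteq> {1..N}"
  shows "real (\<Sum>n\<in>D. card (fracs n m i - high_denom Q n))
    \<le> (\<Sum>q=1..Q. real N / real q * (real q / real m + 1))"
proof -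
  define S where "S = (SIGMA n:D. fracs n m i - high_denom Q n)"
  have cS: "card S = (\<Sum>n\<in>D. card (fracs n m i - high_denom Q n))"
    unfolding S_def using D(1) by (intro card_SigmaI) auto
  define T where "T q = (\<lambda>(g, p). (q * g, g * p)) ` ({1..N div q} \<times> fracs q m i)" for q
  have "S \<subseteq> (\<Union>q\<in>{1..Q}. T q)"
  proof (rule subrelI)
    fix n a assume "(n, a) \<in> S"
    then have na: "n \<in> D" "a \<in> {1..n}" "real a / real n \<in> cell m i" "a \<notin> high_denom Q n"
      unfolding S_def fracs_def by auto
    then obtain q where q: "q \<le> Q" "q dvd n" "n dvd a * q" unfolding high_denom_def by blast
    have n: "1 \<le> n" "n \<le> N" using na(1) D(2) by auto
    obtain g where g: "n = q * g" using q(2) by blast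
    have q0: "q > 0" "g > 0" using g n by (auto intro!: gr0I)
    have "g dvd a" using q(3) q0 unfolding g by (simp add: mult.commute)
    then obtain p where p: "a = g * p" by blast
    have "g \<le> N div q" using g n q0 by (simp add: less_eq_div_iff_mult_less_eq mult.commute)
    moreover have "p \<in> fracs q m i"
    proof -
      have "real a / real n = real p / real q" using g p q0 by simp
      moreover have "1 \<le> p" "p \<le> q" using na(2) g p q0 by auto
      ultimately show ?thesis using na(3) unfolding fracs_def by auto
    qed
    ultimately have "(g, p) \<in> {1..N div q} \<times> fracs q m i" using q0 by auto
    then have "(n, a) \<in> T q" unfolding T_def g p by force
    then show "(n, a) \<in> (\<Union>q\<in>{1..Q}. T q)" using q(1) q0 by auto
  qed
  moreover have "finite (T q)" for q unfolding T_def by auto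
  ultimately have "card S \<le> card (\<Union>q\<in>{1..Q}. T q)" by (intro card_mono) auto
  also have "\<dots> \<le> (\<Sum>q=1..Q. card (T q))" by (rule card_UN_le) simp
  finally have "real (card S) \<le> real (\<Sum>q=1..Q. card (T q))" by (rule of_nat_mono)
  also have "\<dots> = (\<Sum>q=1..Q. real (card (T q)))" by simp
  also have "\<dots> \<le> (\<Sum>q=1..Q. real N / real q * (real q / real m + 1))"
  proof (rule sum_mono)
    fix q assume q: "q \<in> {1..Q}"
    have "card (T q) \<le> card ({1..N div q} \<times> fracs q m i)" unfolding T_def by (rule card_image_le) simp
    also have "\<dots> = (N div q) * card (fracs q m i)" by (simp add: card_cartesian_product)
    finally have "real (card (T q)) \<le> real (N div q) * real (card (fracs q m i))"
      by (metis of_nat_mono of_nat_mult)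
    also have "\<dots> \<le> real N / real q * (real q / real m + 1)"
      using q m by (intro mult_mono of_nat_div_le_of_nat card_fracs_le) auto
    finally show "real (card (T q)) \<le> real N / real q * (real q / real m + 1)" .
  qed
  finally show ?thesis unfolding cS .
qed

text \<open>Distinct rationals with denominators at most \<open>N\<close> differ by at least
  \<open>1 / N^2\<close>, so a cell of level \<open>N^2\<close> contains only one of them,
  \<open>p / q\<close> in lowest terms. Its representations have denominators \<open>n <= N\<close>
  that are multiples of \<open>q\<close>, and \<open>N < q * d\<close> leaves fewer than
  \<open>d\<close> of them.\<close>

lemma card_high_denom_cell_le:
  assumes D: "finite D" "D \<subseteq> {1..N}" and d: "d > 0"
  shows "(\<Sum>n\<in>D. card (fracs n (N\<^sup>2) j \<inter> high_denom (N div d) n)) \<le> d"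
proof -
  define S where "S = (SIGMA n:D. fracs n (N\<^sup>2) j \<inter> high_denom (N div d) n)"
  have cS: "card S = (\<Sum>n\<in>D. card (fracs n (N\<^sup>2) j \<inter> high_denom (N div d) n))"
    unfolding S_def using D(1) by (intro card_SigmaI) auto
  have "card S \<le> d"
  proof (cases "S = {}")
    case False
    then obtain n0 a0 where 0: "(n0, a0) \<in> S" by auto
    have SD: "1 \<le> n \<and> n \<le> N \<and> 1 \<le> a \<and> a \<le> n \<and> real a / real n \<in> cell (N\<^sup>2) j \<and> a \<in> high_denom (N div d) n"
      if "(n, a) \<in> S" for n a using that D(2) unfolding S_def fracs_def by auto
    have N: "N > 0" using SD[OF 0] by simp
    have same: "a * n0 = a0 * n" if "(n, a) \<in> S" for n a
    proof -
      note s = SD[OF 0] SD[OF that]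
      have "\<bar>real a / real n * real (N\<^sup>2) - real a0 / real n0 * real (N\<^sup>2)\<bar> < 1"
        using s N by (auto simp: mem_cell_iff)
      then have "\<bar>real a / real n - real a0 / real n0\<bar> * real (N\<^sup>2) < 1"
        by (metis abs_mult abs_of_nat left_diff_distrib)
      moreover have "\<bar>real a / real n - real a0 / real n0\<bar>
          = \<bar>real (a * n0) - real (a0 * n)\<bar> / (real n * real n0)"
        using s by (simp add: diff_frac_eq)
      ultimately have "\<bar>real (a * n0) - real (a0 * n)\<bar> * real (N\<^sup>2) < real n * real n0"
        using s by (simp add: field_simps)
      also have "\<dots> \<le> real (N\<^sup>2)"
        using s by (simp add: power2_eq_square mult_mono)
      finally have "\<bar>real (a * n0) - real (a0 * n)\<bar> < 1" using N by simp
      then have "\<bar>int (a * n0) - int (a0 * n)\<bar> < 1" by linarith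
      then show ?thesis by linarith
    qed
    define g where "g = gcd a0 n0"
    have g0: "g > 0" using SD[OF 0] unfolding g_def by auto
    obtain p q where pq: "a0 = p * g" "n0 = q * g" "coprime p q"
      using gcd_coprime_exists[of a0 n0] g0 unfolding g_def by auto
    have "n0 dvd a0 * q" using pq by (simp add: mult.commute mult.left_commute)
    moreover have "q dvd n0" using pq by simp
    ultimately have "\<not> q \<le> N div d" using SD[OF 0] unfolding high_denom_def by blast
    then have "N div d < q" by simp
    then have Nq: "N < q * d" using d by (simp add: div_less_iff_less_mult)
    have q0: "q > 0" using SD[OF 0] pq by (auto intro!: gr0I)
    have qn: "q dvd n" if "(n, a) \<in> S" for n a
    proof -
      have "a * q * g = p * n * g" using same[OF that] unfolding pq by (simp add: ac_simps)
      then have "a * q = p * n" using g0 by simp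
      then have "q dvd p * n" by (metis dvd_triv_right)
      then show ?thesis using pq(3) by (simp add: coprime_dvd_mult_right_iff coprime_commute)
    qed
    \<comment> \<open>All pairs represent the same rational, so \<open>n\<close> determines
      \<open>a\<close>, and \<open>n div q\<close> determines \<open>n\<close>.\<close>
    have "inj_on (\<lambda>z. fst z div q) S"
    proof (rule inj_onI)
      fix y z assume yz: "y \<in> S" "z \<in> S" "fst y div q = fst z div q"
      obtain n a n' a' where e: "y = (n, a)" "z = (n', a')" by (cases y, cases z)
      have n: "n = n'" using yz qn[of n a] qn[of n' a'] unfolding e by (metis dvd_div_mult_self fst_conv)
      then have "a * n0 = a' * n0" using same yz unfolding e by simp
      then show "y = z" using n SD[OF 0] unfolding e by simp
    qed
    moreover have "(\<lambda>z. fst z div q) ` S \<subseteq> {..<d}"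
    proof clarify
      fix n a assume "(n, a) \<in> S"
      then have "n < q * d" using SD[of n a] Nq by auto
      then show "fst (n, a) div q < d" using q0 by (simp add: div_less_iff_less_mult mult.commute)
    qed
    ultimately have "card S \<le> card {..<d}" by (intro card_inj_on_le) auto
    then show ?thesis by simp
  qed simp
  then show ?thesis unfolding cS .
qed

text \<open>A crude substitute for the logarithm. Multiplied by \<open>N\<close> it stays of smaller
  order than \<open>N^2\<close>, which suffices later. The induction step is
  \<open>1 / (Q + 1) <= 2 * (sqrt (Q + 1) - sqrt Q)\<close>.\<close>

lemma sum_inverse_le_sqrt: "(\<Sum>q=1..Q. 1 / real q) \<le> 2 * sqrt (real Q)"
proof (induction Q)
  case (Suc Q)
  define s t where "s = sqrt (real Q)" and "t = sqrt (real (Suc Q))"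
  have t: "t\<^sup>2 = real (Suc Q)" "s\<^sup>2 = real Q" "1 \<le> t" "0 \<le> s" "s \<le> t"
    unfolding s_def t_def by auto
  have "1 = (t - s) * (t + s)" using t by (simp add: algebra_simps power2_eq_square)
  also have "\<dots> \<le> (t - s) * (2 * t)" using t by (intro mult_left_mono) auto
  finally have *: "1 / (2 * t) \<le> t - s" using t by (simp add: field_simps)
  have "t * 1 \<le> t * t" using t by (intro mult_left_mono) auto
  then have "t \<le> real (Suc Q)" using t(1) by (simp add: power2_eq_square)
  then have "1 / real (Suc Q) \<le> 1 / t" using t(3) by (intro divide_left_mono) auto
  moreover have "1 / t = 2 * (1 / (2 * t))" by simp
  ultimately have "1 / real (Suc Q) \<le> 2 * t - 2 * s" using * by linarith
  moreover have "(\<Sum>q=1..Suc Q. 1 / real q) = (\<Sum>q=1..Q. 1 / real q) + 1 / real (Suc Q)"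
    by (subst sum.nat_ivl_Suc') (simp_all only: add.commute)
  ultimately show ?case using Suc unfolding s_def t_def by linarith
qed simp

section \<open>The two growth regimes\<close>

text \<open>All that the almost sure statement and the divergence case ask of the growth of
  \<open>f\<close>, so that both regimes feed the same argument.\<close>

definition regular_scales :: "(nat \<Rightarrow> int) \<Rightarrow> nat \<Rightarrow> (nat \<Rightarrow> nat) \<Rightarrow> real \<Rightarrow> real \<Rightarrow> bool" where
  "regular_scales f M m \<kappa> C \<longleftrightarrow> M \<ge> 2 \<and> \<kappa> > 0 \<and>
    (\<forall>k. m k > 0 \<and> 2 * m k \<le> m (Suc k) \<and> m k dvd m (Suc k)) \<and>
    (\<forall>\<^sub>F k in sequentially. (\<Sum>n\<in>block M (Suc k). real_of_int (f n)) \<le> C * real (m k)) \<and>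
    (\<forall>r. \<forall>i<m r. \<forall>\<^sub>F k in sequentially. 2 * \<kappa> * (real (m k) / real (m r))
      \<le> (\<Sum>j\<in>subcells (m r) (m k) i. 1 - exp (- intensity f (block M k) (m k) j)))"

lemma finite_block [simp]: "finite (block M k)"
  unfolding block_def by simp

lemma sum_block_eq:
  fixes g :: "nat \<Rightarrow> real"
  assumes "M \<ge> 2"
  shows "(\<Sum>n\<in>block M k. g n) = (\<Sum>n=1..M ^ (k + 2). g n) - (\<Sum>n=1..M ^ (k + 1). g n)"
proof -
  have *: "{1..b} \<union> {b<..c} = {1..c}" if "1 \<le> b" "b \<le> c" for b c :: nat using that by auto
  have "M ^ (k + 1) \<le> M ^ (k + 2)" using assms by (intro power_increasing) auto
  moreover have "1 \<le> M ^ (k + 1)" using assms by (intro one_le_power) auto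
  ultimately have "{1..M ^ (k + 2)} = {1..M ^ (k + 1)} \<union> block M k" unfolding block_def using * by metis
  moreover have "{1..M ^ (k + 1)} \<inter> block M k = {}" unfolding block_def by auto
  ultimately have "(\<Sum>n=1..M ^ (k + 2). g n) = (\<Sum>n=1..M ^ (k + 1). g n) + (\<Sum>n\<in>block M k. g n)"
    by (metis sum.union_disjoint finite_block finite_atLeastAtMost)
  then show ?thesis by simp
qed

lemma filterlim_power_add:
  assumes "(M::nat) \<ge> 2"
  shows "filterlim (\<lambda>k. M ^ (k + c)) at_top sequentially"
proof (rule filterlim_at_top_mono[OF filterlim_ident], intro always_eventually allI)
  fix k :: nat
  have "k + c < 2 ^ (k + c)" by (rule less_exp)
  also have "\<dots> \<le> M ^ (k + c)" using assms by (intro power_mono) auto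
  finally show "k \<le> M ^ (k + c)" by simp
qed

section \<open>Bounded average order\<close>

text \<open>With \<open>m k = M^k\<close> every single cell is likely to be hit. The denominators of
  block \<open>k\<close> exceed \<open>2 * m k\<close>, so rounding costs at most half, and a cell
  holds at least \<open>n / (2 * m k)\<close> of the fractions with denominator \<open>n\<close>.
  Its intensity is then at least \<open>b / 2\<close>.\<close>

lemma regular_scales_bounded:
  assumes f: "\<And>n. n \<ge> 1 \<Longrightarrow> 0 \<le> f n \<and> f n \<le> int n" and avg: "average_order_positive_bounded f"
  obtains M m \<kappa> C where "regular_scales f M m \<kappa> C"
proof -
  define F where "F N = (\<Sum>n=1..N. real_of_int (f n))" for N
  obtain a b where ab: "0 < a" "a < b" "\<forall>\<^sub>F N in sequentially. a * real N \<le> F N \<and> F N \<le> b * real N"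
    using avg unfolding average_order_positive_bounded_def F_def by blast
  \<comment> \<open>With \<open>a * M >= 2 * b\<close>, the sum of \<open>f\<close> up to
    \<open>M^(k + 1)\<close> is at most half of the lower bound \<open>a * M^(k + 2)\<close>, and at
    least \<open>b * M^(k + 1)\<close> remains for the block.\<close>
  define M where "M = nat \<lceil>2 * b / a\<rceil> + 2"
  have M: "M \<ge> 2" "2 * b \<le> a * real M"
  proof -
    show "M \<ge> 2" unfolding M_def by simp
    have "2 * b / a \<le> real M" unfolding M_def by linarith
    then show "2 * b \<le> a * real M" using ab by (simp add: field_simps)
  qed
  have ev: "\<forall>\<^sub>F k in sequentially. a * real (M ^ (k + c)) \<le> F (M ^ (k + c)) \<and> F (M ^ (k + c)) \<le> b * real (M ^ (k + c))" for c
    using eventually_compose_filterlim[OF ab(3) filterlim_power_add[OF M(1)]] .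
  define \<kappa> where "\<kappa> = (1 - exp (- (b / 2))) / 2"
  have F0: "0 \<le> F N" for N unfolding F_def using f by (intro sum_nonneg) auto
  have "regular_scales f M (\<lambda>k. M ^ k) \<kappa> (b * real M ^ 3)"
    unfolding regular_scales_def
  proof (intro conjI allI impI)
    show "2 \<le> M" by (rule M)
    show "0 < \<kappa>" unfolding \<kappa>_def using ab by simp
    show "0 < M ^ k" for k using M by simp
    show "2 * M ^ k \<le> M ^ Suc k" for k using M(1) by simp
    show "M ^ k dvd M ^ Suc k" for k by simp
    show "\<forall>\<^sub>F k in sequentially. (\<Sum>n\<in>block M (Suc k). real_of_int (f n)) \<le> b * real M ^ 3 * real (M ^ k)"
      using ev[of 3]
    proof eventually_elim
      case (elim k)
      have "Suc k + 2 = k + 3" by simp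
      then have "(\<Sum>n\<in>block M (Suc k). real_of_int (f n)) = F (M ^ (k + 3)) - F (M ^ (Suc k + 1))"
        unfolding F_def using sum_block_eq[OF M(1)] by metis
      then have "(\<Sum>n\<in>block M (Suc k). real_of_int (f n)) \<le> F (M ^ (k + 3))"
        using F0[of "M ^ (Suc k + 1)"] by linarith
      also have "\<dots> \<le> b * real (M ^ (k + 3))" using elim by simp
      also have "\<dots> = b * real M ^ 3 * real (M ^ k)" by (simp add: power_add ac_simps)
      finally show ?case .
    qed
    fix r i assume i: "i < M ^ r"
    show "\<forall>\<^sub>F k in sequentially. 2 * \<kappa> * (real (M ^ k) / real (M ^ r))
      \<le> (\<Sum>j\<in>subcells (M ^ r) (M ^ k) i. 1 - exp (- intensity f (block M k) (M ^ k) j))"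
      using ev[of 1] ev[of 2] eventually_ge_at_top[of r]
    proof eventually_elim
      case (elim k)
      define m where "m = M ^ k"
      have m0: "m > 0" unfolding m_def using M by simp
      have "b * real m \<le> b * (real M * real m)"
        using ab M m0 by (intro mult_left_mono) auto
      also have "\<dots> = 2 * b * (real M * real m) - b * (real M * real m)" by simp
      also have "\<dots> \<le> a * real M * (real M * real m) - b * (real M * real m)"
        using M by (intro diff_right_mono mult_right_mono) auto
      also have "\<dots> = a * real (M ^ (k + 2)) - b * real (M ^ (k + 1))"
        by (simp add: m_def power_add power2_eq_square ac_simps)
      also have "\<dots> \<le> F (M ^ (k + 2)) - F (M ^ (k + 1))" using elim by (intro diff_mono) auto
      also have "\<dots> = (\<Sum>n\<in>block M k. real_of_int (f n))"
        unfolding F_def using sum_block_eq[OF M(1)] by simp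
      finally have sum_ge: "b * real m \<le> (\<Sum>n\<in>block M k. real_of_int (f n))" .
      have int_ge: "b / 2 \<le> intensity f (block M k) m j" if j: "j < m" for j
      proof -
        have "b / 2 = b * real m / (2 * real m)" using m0 by simp
        also have "\<dots> \<le> (\<Sum>n\<in>block M k. real_of_int (f n)) / (2 * real m)"
          using sum_ge by (intro divide_right_mono) auto
        also have "\<dots> = (\<Sum>n\<in>block M k. real_of_int (f n) / (2 * real m))"
          by (rule sum_divide_distrib)
        also have "\<dots> \<le> intensity f (block M k) m j"
          unfolding intensity_def
        proof (rule sum_mono)
          fix n assume n: "n \<in> block M k"
          have "2 * m \<le> M * m" using M by (intro mult_right_mono) auto
          also have "\<dots> < n" using n unfolding block_def m_def by simp
          finally have n2: "2 * real m \<le> real n" by linarith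
          then have n0: "n > 0" "1 \<le> real n / (2 * real m)" using m0 by (auto simp: field_simps)
          have "real n / (2 * real m) = real n / real m - real n / (2 * real m)" using m0 by (simp add: field_simps)
          also have "\<dots> \<le> real n / real m - 1" using n0(2) by simp
          also have "\<dots> \<le> real (card (fracs n m j))" using m0 n0(1) j by (rule card_fracs_ge)
          finally have "real_of_int (f n) / real n * (real n / (2 * real m))
              \<le> real_of_int (f n) / real n * real (card (fracs n m j))"
            using f[of n] n0(1) by (intro mult_left_mono) auto
          then show "real_of_int (f n) / (2 * real m) \<le> real_of_int (f n) / real n * real (card (fracs n m j))"
            using n0(1) by simp
        qed
        finally show ?thesis .
      qed
      have "2 * \<kappa> * (real m / real (M ^ r)) = (\<Sum>j\<in>subcells (M ^ r) m i. 1 - exp (- (b / 2)))"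
      proof -
        have "2 * \<kappa> = 1 - exp (- (b / 2))" unfolding \<kappa>_def by simp
        moreover have "real (card (subcells (M ^ r) m i)) = real m / real (M ^ r)"
          unfolding m_def using elim(3) by (intro real_card_subcells le_imp_power_dvd)
        ultimately show ?thesis unfolding sum_constant by (simp only: mult.commute)
      qed
      also have "\<dots> \<le> (\<Sum>j\<in>subcells (M ^ r) m i. 1 - exp (- intensity f (block M k) m j))"
        using int_ge subcells_less[OF i] by (intro sum_mono) auto
      finally show ?case unfolding m_def .
    qed
  qed
  then show thesis by (rule that)
qed

section \<open>Average order at least linear\<close>

text \<open>Replaces the concave occupancy bound by a linear one for a part \<open>z\<close> of the
  intensity that is at most \<open>d\<close>; the linear bound can be summed over cells.\<close>

lemma one_minus_exp_ge:
  fixes x z d :: real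
  assumes "0 \<le> z" "z \<le> x" "z \<le> d"
  shows "z / (1 + d) \<le> 1 - exp (- x)"
proof -
  have "z / (1 + d) \<le> z / (1 + z)" using assms by (intro divide_left_mono) auto
  also have "\<dots> = 1 - 1 / (1 + z)" using assms by (simp add: field_simps)
  also have "\<dots> \<le> 1 - exp (- z)"
  proof -
    have "1 + z \<le> exp z" by (rule exp_ge_add_one_self)
    then have "exp (- z) \<le> 1 / (1 + z)" using assms by (simp add: exp_minus field_simps)
    then show ?thesis by simp
  qed
  also have "\<dots> \<le> 1 - exp (- x)" using assms by simp
  finally show ?thesis .
qed

text \<open>Only fractions of high reduced denominator are kept, so that the remaining intensity
  \<open>Z j\<close> is at most \<open>d\<close> and the linear bound applies. Summed over the
  subcells, \<open>Z\<close> counts such fractions in the coarse cell. The loss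
  \<open>N^2 / (d * m)\<close> and two of the three \<open>N * sqrt N\<close> come from low
  denominators.\<close>

lemma sum_intensity_ge:
  assumes f: "\<And>n. n \<ge> 1 \<Longrightarrow> 0 \<le> f n \<and> f n \<le> int n"
    and m: "m > 0" "i < m" "m dvd N\<^sup>2" and N: "N > 0" and D: "D \<subseteq> {1..N}" and d: "d > 0"
  shows "((\<Sum>n\<in>D. real_of_int (f n)) / real m - (real N)\<^sup>2 / (real d * real m) - 3 * real N * sqrt (real N)) / (1 + real d)
    \<le> (\<Sum>j\<in>subcells m (N\<^sup>2) i. 1 - exp (- intensity f D (N\<^sup>2) j))"
proof -
  have fD: "finite D" using D finite_subset by blast
  define Q where "Q = N div d"
  define w where "w n = real_of_int (f n) / real n" for n
  have w: "0 \<le> w n" "w n \<le> 1" if "n \<in> D" for n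
    using f[of n] that D unfolding w_def by (auto simp: field_simps)
  define Z where "Z j = (\<Sum>n\<in>D. w n * real (card (fracs n (N\<^sup>2) j \<inter> high_denom Q n)))" for j
  have Z0: "0 \<le> Z j" for j unfolding Z_def using w by (intro sum_nonneg mult_nonneg_nonneg) auto
  have Zi: "Z j \<le> intensity f D (N\<^sup>2) j" for j
    unfolding Z_def intensity_def w_def[symmetric]
    using w by (intro sum_mono mult_left_mono) (auto intro: card_mono)
  have Zd: "Z j \<le> real d" for j
  proof -
    have "Z j \<le> (\<Sum>n\<in>D. 1 * real (card (fracs n (N\<^sup>2) j \<inter> high_denom Q n)))"
      unfolding Z_def using w by (intro sum_mono mult_right_mono) auto
    also have "\<dots> = real (\<Sum>n\<in>D. card (fracs n (N\<^sup>2) j \<inter> high_denom Q n))" by simp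
    also have "\<dots> \<le> real d"
      unfolding Q_def using card_high_denom_cell_le[OF fD D d] by (rule of_nat_mono)
    finally show ?thesis .
  qed
  have N2: "N\<^sup>2 > 0" using N by simp
  have "(\<Sum>j\<in>subcells m (N\<^sup>2) i. Z j)
      = (\<Sum>n\<in>D. \<Sum>j\<in>subcells m (N\<^sup>2) i. w n * real (card (fracs n (N\<^sup>2) j \<inter> high_denom Q n)))"
    unfolding Z_def by (rule sum.swap)
  also have "\<dots> = (\<Sum>n\<in>D. w n * real (card (fracs n m i \<inter> high_denom Q n)))"
  proof (rule sum.cong[OF refl])
    fix n
    have "fracs n m i \<inter> high_denom Q n = (\<Union>j\<in>subcells m (N\<^sup>2) i. fracs n (N\<^sup>2) j \<inter> high_denom Q n)"
      using fracs_subcells[OF m(1) N2 m(3), of n i] by blast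
    also have "card \<dots> = (\<Sum>j\<in>subcells m (N\<^sup>2) i. card (fracs n (N\<^sup>2) j \<inter> high_denom Q n))"
      using fracs_disjoint[OF N2] by (intro card_UN_disjoint) auto
    finally show "(\<Sum>j\<in>subcells m (N\<^sup>2) i. w n * real (card (fracs n (N\<^sup>2) j \<inter> high_denom Q n)))
        = w n * real (card (fracs n m i \<inter> high_denom Q n))"
      by (simp add: sum_distrib_left)
  qed
  \<comment> \<open>The weight \<open>w n\<close> is at most 1, so rounding costs at most 1 for each
    \<open>n\<close> and every discarded fraction costs at most 1.\<close>
  also have "\<dots> \<ge> (\<Sum>n\<in>D. real_of_int (f n) / real m - 1 - real (card (fracs n m i - high_denom Q n)))"
  proof (rule sum_mono)
    fix n assume n: "n \<in> D"
    then have n0: "n > 0" using D by auto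
    let ?b = "real (card (fracs n m i - high_denom Q n))" and ?g = "real (card (fracs n m i \<inter> high_denom Q n))"
    have "card (fracs n m i) = card (fracs n m i \<inter> high_denom Q n) + card (fracs n m i - high_denom Q n)"
      by (subst card_Un_disjoint[symmetric]) (auto intro: arg_cong[where f = card])
    then have eq: "real (card (fracs n m i)) = ?g + ?b" by simp
    have "real_of_int (f n) / real m - w n = w n * (real n / real m - 1)"
      unfolding w_def using n0 by (simp add: field_simps)
    also have "\<dots> \<le> w n * real (card (fracs n m i))"
      using w[OF n] m n0 by (intro mult_left_mono card_fracs_ge) auto
    also have "\<dots> = w n * ?g + w n * ?b" unfolding eq by (rule distrib_left)
    also have "w n * ?b \<le> 1 * ?b" using w[OF n] by (intro mult_right_mono) auto
    finally show "real_of_int (f n) / real m - 1 - ?b \<le> w n * ?g" using w[OF n] by linarith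
  qed
  finally have low: "(\<Sum>n\<in>D. real_of_int (f n) / real m - 1 - real (card (fracs n m i - high_denom Q n)))
    \<le> (\<Sum>j\<in>subcells m (N\<^sup>2) i. Z j)" .
  have "real (\<Sum>n\<in>D. card (fracs n m i - high_denom Q n))
      \<le> (\<Sum>q=1..Q. real N / real q * (real q / real m + 1))"
    by (rule card_low_denom_le[OF m(1,2) fD D])
  also have "\<dots> = (\<Sum>q=1..Q. real N / real m + real N * (1 / real q))"
    using m by (intro sum.cong refl) (simp add: field_simps)
  also have "\<dots> = real Q * (real N / real m) + real N * (\<Sum>q=1..Q. 1 / real q)"
    by (simp add: sum.distrib sum_distrib_left)
  also have "\<dots> \<le> (real N / real d) * (real N / real m) + real N * (2 * sqrt (real N))"
  proof (intro add_mono mult_right_mono mult_left_mono)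
    show "real Q \<le> real N / real d" unfolding Q_def by (rule of_nat_div_le_of_nat)
    have "Q \<le> N" unfolding Q_def by simp
    then have "sqrt (real Q) \<le> sqrt (real N)" by simp
    then show "(\<Sum>q=1..Q. 1 / real q) \<le> 2 * sqrt (real N)"
      using sum_inverse_le_sqrt[of Q] by linarith
  qed auto
  finally have bad: "real (\<Sum>n\<in>D. card (fracs n m i - high_denom Q n))
    \<le> (real N)\<^sup>2 / (real d * real m) + 2 * real N * sqrt (real N)"
    by (simp add: power2_eq_square)
  \<comment> \<open>The rounding losses, at most \<open>N\<close> in total, are the third
    \<open>N * sqrt N\<close>.\<close>
  have "card D \<le> card {1..N}" using D by (intro card_mono) auto
  moreover have "real N * 1 \<le> real N * sqrt (real N)" using N by (intro mult_left_mono) auto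
  ultimately have "real (card D) \<le> real N * sqrt (real N)" by simp
  then have "(\<Sum>n\<in>D. real_of_int (f n)) / real m - (real N)\<^sup>2 / (real d * real m) - 3 * real N * sqrt (real N)
     \<le> (\<Sum>n\<in>D. real_of_int (f n) / real m - 1 - real (card (fracs n m i - high_denom Q n)))"
    using bad by (simp add: sum_subtractf sum_divide_distrib)
  also note low
  finally have "((\<Sum>n\<in>D. real_of_int (f n)) / real m - (real N)\<^sup>2 / (real d * real m) - 3 * real N * sqrt (real N)) / (1 + real d)
     \<le> (\<Sum>j\<in>subcells m (N\<^sup>2) i. Z j) / (1 + real d)"
    by (intro divide_right_mono) auto
  also have "\<dots> = (\<Sum>j\<in>subcells m (N\<^sup>2) i. Z j / (1 + real d))" by (rule sum_divide_distrib)
  also have "\<dots> \<le> (\<Sum>j\<in>subcells m (N\<^sup>2) i. 1 - exp (- intensity f D (N\<^sup>2) j))"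
    using Z0 Zi Zd by (intro sum_mono one_minus_exp_ge)
  finally show ?thesis .
qed

lemma sum_real_nat: "(\<Sum>n=1..N. real n) = real N * (real N + 1) / 2"
  by (induction N) (auto simp: field_simps)

text \<open>With \<open>N = M^(k + 2)\<close> the end of block \<open>k\<close>, take
  \<open>m k = N^2\<close>. A lower bound for each single cell is out of reach at this scale, since
  a cell holds at most one rational of denominator up to \<open>N\<close>; only the average over the
  subcells of a fixed cell is bounded.\<close>

lemma regular_scales_linear:
  assumes f: "\<And>n. n \<ge> 1 \<Longrightarrow> 0 \<le> f n \<and> f n \<le> int n" and avg: "average_order_at_least_linear f"
  obtains M m \<kappa> C where "regular_scales f M m \<kappa> C"
proof -
  define F where "F N = (\<Sum>n=1..N. real_of_int (f n))" for N
  obtain a where a: "0 < a" "\<forall>\<^sub>F N in sequentially. a * (\<Sum>n=1..N. real n) \<le> F N"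
    using avg unfolding average_order_at_least_linear_def F_def by blast
  \<comment> \<open>The sum of \<open>f\<close> up to \<open>N / M\<close> is at most
    \<open>N^2 / M^2 <= a * N^2 / 4\<close>, half of the lower bound \<open>a * N^2 / 2\<close> for
    the sum up to \<open>N\<close>.\<close>
  define M where "M = nat \<lceil>4 / a\<rceil> + 2"
  have M: "M \<ge> 2" "4 \<le> a * (real M)\<^sup>2"
  proof -
    show "M \<ge> 2" unfolding M_def by simp
    have "4 / a \<le> real M" unfolding M_def by linarith
    also have "\<dots> \<le> (real M)\<^sup>2" unfolding power2_eq_square M_def by simp
    finally show "4 \<le> a * (real M)\<^sup>2" using a by (simp add: field_simps)
  qed
  define d where "d = nat \<lceil>16 / a\<rceil> + 1"
  have d: "d > 0" "16 / a \<le> real d" unfolding d_def by (simp, linarith)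
  \<comment> \<open>In units of \<open>a * N^2 / m r\<close>, the block contributes 1/4, low
    denominators cost 1/16 because \<open>d >= 16 / a\<close>, and the terms
    \<open>N * sqrt N\<close> cost 1/8. The remaining 1/16 is divided by
    \<open>1 + d\<close>.\<close>
  define \<kappa> where "\<kappa> = a / (16 * (1 + real d)) / 2"
  define m where "m k = (M ^ (k + 2))\<^sup>2" for k
  have F0: "0 \<le> F N" for N unfolding F_def using f by (intro sum_nonneg) auto
  have F_le: "F N \<le> (real N)\<^sup>2" for N
  proof -
    have "F N \<le> (\<Sum>n=1..N. real n)" unfolding F_def
    proof (rule sum_mono)
      fix n assume "n \<in> {1..N}"
      then have "f n \<le> int n" using f by auto
      then have "real_of_int (f n) \<le> real_of_int (int n)" by (rule of_int_le_iff[THEN iffD2])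
      then show "real_of_int (f n) \<le> real n" by simp
    qed
    also have "\<dots> \<le> (real N)\<^sup>2" unfolding sum_real_nat by (cases N) (auto simp: field_simps power2_eq_square)
    finally show ?thesis .
  qed
  have blocks: "(\<Sum>n\<in>block M k. real_of_int (f n)) = F (M ^ (k + 2)) - F (M ^ (k + 1))" for k
    unfolding F_def using M(1) by (rule sum_block_eq)
  have dvd: "m r dvd m k" if "r \<le> k" for r k
    unfolding m_def using that by (intro dvd_power_same le_imp_power_dvd) simp
  have "regular_scales f M m \<kappa> ((real M)\<^sup>2)"
    unfolding regular_scales_def
  proof (intro conjI allI impI)
    show "2 \<le> M" by (rule M)
    show "0 < \<kappa>" unfolding \<kappa>_def using a by (simp add: add_pos_nonneg)
    show m0: "0 < m k" for k unfolding m_def using M by simp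
    show "2 * m k \<le> m (Suc k)" for k
    proof -
      have "m (Suc k) = M * M * m k" unfolding m_def by (simp add: power2_eq_square)
      moreover have "2 * 1 \<le> M * M" using M(1) by (intro mult_mono) auto
      ultimately show ?thesis by (metis mult.right_neutral mult_le_mono1)
    qed
    show "m k dvd m (Suc k)" for k by (rule dvd) simp
    show "\<forall>\<^sub>F k in sequentially. (\<Sum>n\<in>block M (Suc k). real_of_int (f n)) \<le> (real M)\<^sup>2 * real (m k)"
    proof (intro always_eventually allI)
      fix k
      have "(\<Sum>n\<in>block M (Suc k). real_of_int (f n)) \<le> F (M ^ (Suc k + 2))"
        using blocks[of "Suc k"] F0[of "M ^ (Suc k + 1)"] by linarith
      also have "\<dots> \<le> (real (M ^ (Suc k + 2)))\<^sup>2" by (rule F_le)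
      also have "\<dots> = (real M)\<^sup>2 * real (m k)"
        unfolding m_def by (simp add: power_mult_distrib power2_eq_square ac_simps)
      finally show "(\<Sum>n\<in>block M (Suc k). real_of_int (f n)) \<le> (real M)\<^sup>2 * real (m k)" .
    qed
    fix r i assume i: "i < m r"
    define \<mu> where "\<mu> = real (m r)"
    have \<mu>: "\<mu> > 0" unfolding \<mu>_def using m0 by simp
    \<comment> \<open>This threshold gives \<open>3 * N * sqrt N <= a * N^2 / (8 * \<mu>)\<close>.
      It depends on \<open>r\<close>, which is harmless because the bound is only claimed for large
      \<open>k\<close>.\<close>
    have "\<forall>\<^sub>F N in sequentially. (24 * \<mu> / a)\<^sup>2 \<le> real N"
      using eventually_ge_at_top[of "nat \<lceil>(24 * \<mu> / a)\<^sup>2\<rceil>"] by eventually_elim linarith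
    from eventually_compose_filterlim[OF this filterlim_power_add[OF M(1)], of 2]
      eventually_compose_filterlim[OF a(2) filterlim_power_add[OF M(1)], of 2] eventually_ge_at_top[of r]
    show "\<forall>\<^sub>F k in sequentially. 2 * \<kappa> * (real (m k) / real (m r))
      \<le> (\<Sum>j\<in>subcells (m r) (m k) i. 1 - exp (- intensity f (block M k) (m k) j))"
    proof eventually_elim
      case (elim k)
      define N where "N = M ^ (k + 2)"
      define N1 where "N1 = M ^ (k + 1)"
      have N: "N > 0" "real N = real M * real N1" "m k = N\<^sup>2"
        unfolding N_def N1_def m_def using M(1) by auto
      have "a * (real N)\<^sup>2 / 2 \<le> a * (real N * (real N + 1) / 2)"
        using a by (simp add: power2_eq_square field_simps)
      also have "\<dots> \<le> F N" using elim(2) unfolding N_def[symmetric] sum_real_nat .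
      finally have FN: "a * (real N)\<^sup>2 / 2 \<le> F N" .
      have "4 * (real N1)\<^sup>2 \<le> a * (real M)\<^sup>2 * (real N1)\<^sup>2" using M(2) by (intro mult_right_mono) auto
      then have "(real N1)\<^sup>2 \<le> a * (real N)\<^sup>2 / 4" unfolding N(2) by (simp add: power_mult_distrib)
      then have block_ge: "a * (real N)\<^sup>2 / 4 \<le> (\<Sum>n\<in>block M k. real_of_int (f n))"
        using FN F_le[of N1] unfolding blocks N_def[symmetric] N1_def[symmetric] by linarith
      have "sqrt ((24 * \<mu> / a)\<^sup>2) \<le> sqrt (real N)" using elim(1) unfolding N_def[symmetric] by (rule real_sqrt_le_mono)
      then have "24 * \<mu> / a \<le> sqrt (real N)" using a \<mu> by simp
      then have s: "24 * \<mu> \<le> a * sqrt (real N)" using a by (simp add: field_simps)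
      have "24 * \<mu> * (real N * sqrt (real N)) \<le> a * sqrt (real N) * (real N * sqrt (real N))"
        using s by (intro mult_right_mono) auto
      also have "\<dots> = a * (real N)\<^sup>2" by (simp add: power2_eq_square)
      finally have e1: "3 * real N * sqrt (real N) \<le> a * (real N)\<^sup>2 / (8 * \<mu>)"
        using \<mu> by (simp add: field_simps)
      have "(real N)\<^sup>2 / (real d * \<mu>) \<le> (real N)\<^sup>2 / (16 / a * \<mu>)"
        using d a \<mu> by (intro divide_left_mono mult_right_mono) auto
      then have e2: "(real N)\<^sup>2 / (real d * \<mu>) \<le> a * (real N)\<^sup>2 / (16 * \<mu>)" by (simp add: ac_simps)
      have e3: "a * (real N)\<^sup>2 / 4 / \<mu> \<le> (\<Sum>n\<in>block M k. real_of_int (f n)) / \<mu>"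
        using block_ge \<mu> by (intro divide_right_mono) auto
      have "a * (real N)\<^sup>2 / (16 * \<mu>)
          = a * (real N)\<^sup>2 / 4 / \<mu> - a * (real N)\<^sup>2 / (16 * \<mu>) - a * (real N)\<^sup>2 / (8 * \<mu>)"
        using \<mu> by (simp add: field_simps)
      also have "\<dots> \<le> (\<Sum>n\<in>block M k. real_of_int (f n)) / \<mu> - (real N)\<^sup>2 / (real d * \<mu>) - 3 * real N * sqrt (real N)"
        using e1 e2 e3 by (intro diff_mono)
      finally have "a * (real N)\<^sup>2 / (16 * \<mu>) / (1 + real d)
          \<le> ((\<Sum>n\<in>block M k. real_of_int (f n)) / \<mu> - (real N)\<^sup>2 / (real d * \<mu>) - 3 * real N * sqrt (real N)) / (1 + real d)"
        by (intro divide_right_mono) auto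
      also have "\<dots> \<le> (\<Sum>j\<in>subcells (m r) (N\<^sup>2) i. 1 - exp (- intensity f (block M k) (N\<^sup>2) j))"
        unfolding \<mu>_def
      proof (rule sum_intensity_ge[OF f m0 i _ N(1) _ d(1)])
        show "m r dvd N\<^sup>2" using dvd[OF elim(3)] N(3) by simp
        show "block M k \<subseteq> {1..N}" unfolding block_def N_def by auto
      qed auto
      also have "a * (real N)\<^sup>2 / (16 * \<mu>) / (1 + real d) = 2 * \<kappa> * (real (m k) / real (m r))"
      proof -
        have "2 * (x / 2) = x" for x :: real by simp
        then have "2 * \<kappa> = a / (16 * (1 + real d))" unfolding \<kappa>_def .
        then show ?thesis unfolding N(3) \<mu>_def by (simp add: mult_ac)
      qed
      finally show ?case unfolding N(3) .
    qed
  qed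
  then show thesis by (rule that)
qed

theorem theorem1p2:
  fixes f :: "nat \<Rightarrow> int"
  assumes "\<And>n. n \<ge> 1 \<Longrightarrow> 0 \<le> f n \<and> f n \<le> int n"
    and "average_order_positive_bounded f \<or> average_order_at_least_linear f"
  shows "AE P in P_f f. \<forall>\<Psi> :: nat \<Rightarrow> real.
    (\<forall>n\<ge>1. \<Psi> n \<ge> 0) \<longrightarrow> antimono_on {1..} \<Psi> \<longrightarrow>
      ((\<Sum>n. ennreal (real_of_int (f (Suc n)) * \<Psi> (Suc n))) = \<infinity> \<longrightarrow>
         emeasure lebesgue (W P \<Psi>) = 1) \<and>
      ((\<Sum>n. ennreal (real_of_int (f (Suc n)) * \<Psi> (Suc n))) < \<infinity> \<longrightarrow>
         emeasure lebesgue (W P \<Psi>) = 0)"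
proof -
  obtain M m \<kappa> C where "regular_scales f M m \<kappa> C"
    using assms regular_scales_bounded regular_scales_linear by metis
  then have M: "M \<ge> 2" and \<kappa>: "\<kappa> > 0"
    and m: "\<And>k. m k > 0" "\<And>k. 2 * m k \<le> m (Suc k)" "\<And>k. m k dvd m (Suc k)"
    and C: "\<forall>\<^sub>F k in sequentially. (\<Sum>n\<in>block M (Suc k). real_of_int (f n)) \<le> C * real (m k)"
    and mean: "\<And>r i. i < m r \<Longrightarrow> \<forall>\<^sub>F k in sequentially. 2 * \<kappa> * (real (m k) / real (m r))
      \<le> (\<Sum>j\<in>subcells (m r) (m k) i. 1 - exp (- intensity f (block M k) (m k) j))"
    unfolding regular_scales_def by blast+
  have "block M k \<subseteq> {1..}" for k unfolding block_def by auto
  \<comment> \<open>The exceptional null set is fixed here, before any \<open>\<Psi>\<close>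
    appears; this allows the uncountable quantifier over \<open>\<Psi>\<close> inside the almost
    sure statement.\<close>
  then have "AE P in P_f f. \<forall>r. \<forall>i<m r. \<forall>\<^sub>F k in sequentially.
    \<kappa> * (real (m k) / real (m r)) \<le> real (card (subcells (m r) (m k) i \<inter> hit (block M k) (m k) P))"
    using assms(1) m \<kappa> mean by (intro AE_hit) auto
  then show ?thesis
  proof (rule AE_mp, intro AE_I2 impI allI conjI)
    fix P and \<Psi> :: "nat \<Rightarrow> real"
    assume P: "P \<in> space (P_f f)" and \<Psi>: "\<forall>n\<ge>1. 0 \<le> \<Psi> n" "antimono_on {1..} \<Psi>"
      and ubiq: "\<forall>r. \<forall>i<m r. \<forall>\<^sub>F k in sequentially. \<kappa> * (real (m k) / real (m r))
        \<le> real (card (subcells (m r) (m k) i \<inter> hit (block M k) (m k) P))"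
    show "emeasure lebesgue (W P \<Psi>) = 1"
      if "(\<Sum>n. ennreal (real_of_int (f (Suc n)) * \<Psi> (Suc n))) = \<infinity>"
      using emeasure_W_eq_1[OF M m _ C \<kappa> _ _ \<Psi>(2) that, of P] assms(1) ubiq \<Psi>(1) by blast
    have "P n \<in> Omega_n f n" if "n \<ge> 1" for n
      using P that unfolding space_P_f by (auto dest: PiE_mem)
    then have "finite (P n) \<and> int (card (P n)) = f n" if "n \<ge> 1" for n
      using that unfolding Omega_n_def by (auto intro: finite_subset)
    then show "emeasure lebesgue (W P \<Psi>) = 0"
      if "(\<Sum>n. ennreal (real_of_int (f (Suc n)) * \<Psi> (Suc n))) < \<infinity>"
      using emeasure_W_eq_0[of P f \<Psi>] \<Psi>(1) that by blast
  qed
qed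

end
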